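(* Let $\tau\in(0,1)$ be a fixed constant. There exists an efficient (polynomial-time) algorithm that, given a two-player game $G=(X\times Y,A\times B,\mu,V)$, produces a biregular two-player game $G_{int}$ with question sets $X_{int}$ and $Y_{int}$ of cardinality at most $$|X_{int}|\le\frac{8|X|^2|Y|}{\tau},\qquad |Y_{int}|\le\frac{8|X||Y|^2}{\tau},$$ with the same answer alphabet size as $G$, and whose values satisfy $$\mathrm{Val}(G)\le\mathrm{Val}(G_{int})\le\mathrm{Val}(G)+\tau,\qquad \mathrm{Val}^*(G)\le\mathrm{Val}^*(G_{int})\le\mathrm{Val}^*(G)+\tau .$$
   Context: A two-player game $G=(X\times Y,A\times B,\mu,V)$ consists of finite question sets $X,Y$, finite answer sets $A,B$, a probability distribution $\mu$ on $X\times Y$, and a predicate $V:A\times B\times X\times Y\to\{0,1\}$. $G$ is biregular if the marginals of $\mu$ on $X$ and on $Y$ are both uniform. $\mathrm{Val}(G)$ is the supremum of $\mathbb E_{(x,y)\sim\mu}\sum_{a,b}V(a,b,x,y)f(x,a)g(y,b)$ over $f:X\times A\to[0,1]$, $g:Y\times B\to[0,1]$ with $\sum_af(x,a)=1$ and $\sum_bg(y,b)=1$ for all $x,y$. $\mathrm{Val}^*(G)$ is the supremum of $\mathbb E_{(x,y)\sim\mu}\sum_{a,b}V(a,b,x,y)\langle\psi|A_x^a\otimes B_y^b|\psi\rangle$ over all integers $d$, unit vectors $|\psi\rangle\in\mathbb C^d\otimes\mathbb C^d$ and positive semidefinite $d\times d$ matrices with $\sum_aA_x^a=\mathrm{Id}$,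 $\sum_bB_y^b=\mathrm{Id}$ for all $x,y$. *)

theory Defs
  imports
    "HOL-Probability.Probability"
    "HOL-Computational_Algebra.Polynomial"
    "HOL-Library.Log_Nat"
    "Jordan_Normal_Form.Schur_Decomposition"
begin

section \<open>Two-player games\<close>

record ('x, 'y, 'a, 'b) game =
  questX :: "'x set"
  questY :: "'y set"
  ansA :: "'a set"
  ansB :: "'b set"
  qdist :: "('x \<times> 'y) pmf"
  win :: "'a \<Rightarrow> 'b \<Rightarrow> 'x \<Rightarrow> 'y \<Rightarrow> bool"

definition two_player_game :: "('x, 'y, 'a, 'b) game \<Rightarrow> bool" where
  "two_player_game G \<longleftrightarrow>
     finite (questX G) \<and> finite (questY G) \<and> finite (ansA G) \<and> finite (ansB G) \<and>
     set_pmf (qdist G) \<subseteq> questX G \<times> questY G"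

definition biregular :: "('x, 'y, 'a, 'b) game \<Rightarrow> bool" where
  "biregular G \<longleftrightarrow>
     map_pmf fst (qdist G) = pmf_of_set (questX G) \<and>
     map_pmf snd (qdist G) = pmf_of_set (questY G)"

definition win_prob ::
  "('x, 'y, 'a, 'b) game \<Rightarrow> ('a \<Rightarrow> 'b \<Rightarrow> 'x \<Rightarrow> 'y \<Rightarrow> real) \<Rightarrow> real" where
  "win_prob G P = measure_pmf.expectation (qdist G)
     (\<lambda>(x, y). \<Sum>a\<in>ansA G. \<Sum>b\<in>ansB G. of_bool (win G a b x y) * P a b x y)"

definition classical_strategy :: "'x set \<Rightarrow> 'a set \<Rightarrow> ('x \<Rightarrow> 'a \<Rightarrow> real) \<Rightarrow> bool" where
  "classical_strategy X A f \<longleftrightarrow>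
     (\<forall>x\<in>X. (\<forall>a\<in>A. 0 \<le> f x a \<and> f x a \<le> 1) \<and> (\<Sum>a\<in>A. f x a) = 1)"

text \<open>
  An empty answer set admits no strategy, and then both values below are the
  unspecified real number \<^term>\<open>Sup {} :: real\<close>. In all other cases the
  suprema are over nonempty subsets of the unit interval.
\<close>

definition Val :: "('x, 'y, 'a, 'b) game \<Rightarrow> real" where
  "Val G = Sup {win_prob G (\<lambda>a b x y. f x a * g y b) | f g.
     classical_strategy (questX G) (ansA G) f \<and> classical_strategy (questY G) (ansB G) g}"

definition psd :: "nat \<Rightarrow> complex mat \<Rightarrow> bool" where
  "psd d M \<longleftrightarrow> M \<in> carrier_mat d d \<and> mat_adjoint M = M \<and>
     (\<forall>v\<in>carrier_vec d. 0 \<le> Re ((M *\<^sub>v v) \<bullet>c v))"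

text \<open>
  The Kronecker product. Vectors of the tensor square of the \<open>d\<close>-dimensional space are
  vectors of dimension \<open>d * d\<close>; the basis vector \<open>e\<^sub>i \<otimes> e\<^sub>j\<close> has index \<open>i * d + j\<close>.
\<close>

definition kron :: "complex mat \<Rightarrow> complex mat \<Rightarrow> complex mat" where
  "kron M N = mat (dim_row M * dim_row N) (dim_col M * dim_col N)
     (\<lambda>(i, j). M $$ (i div dim_row N, j div dim_col N) * N $$ (i mod dim_row N, j mod dim_col N))"

definition povm_strategy :: "nat \<Rightarrow> 'x set \<Rightarrow> 'a set \<Rightarrow> ('x \<Rightarrow> 'a \<Rightarrow> complex mat) \<Rightarrow> bool" where
  "povm_strategy d X A F \<longleftrightarrow>
     (\<forall>x\<in>X. (\<forall>a\<in>A. psd d (F x a)) \<and> mat d d (\<lambda>ij. \<Sum>a\<in>A. F x a $$ ij) = 1\<^sub>m d)"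

text \<open>The bracket below is real for positive semidefinite matrices, so taking \<open>Re\<close> loses nothing.\<close>

definition Val_star :: "('x, 'y, 'a, 'b) game \<Rightarrow> real" where
  "Val_star G = Sup {win_prob G (\<lambda>a b x y. Re ((kron (F x a) (H y b) *\<^sub>v \<psi>) \<bullet>c \<psi>)) | d \<psi> F H.
     \<psi> \<in> carrier_vec (d * d) \<and> \<psi> \<bullet>c \<psi> = 1 \<and>
     povm_strategy d (questX G) (ansA G) F \<and> povm_strategy d (questY G) (ansB G) H}"


section \<open>Polynomial time on a random access machine\<close>

text \<open>
  Structured programs for a random access machine with the instruction set and the
  logarithmic cost criterion of Aho, Hopcroft and Ullman: every operation is charged the
  bit lengths of all addresses and numbers it touches, the result included. Up to
  polynomial factors this time is Turing machine time. Subtraction is truncated, division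
  is integer division (with quotient 0 for divisor 0), and reading past the end of the
  input yields 0.
\<close>

datatype addr = Dir nat | Ind nat

datatype operand = Const nat | At addr

datatype binop = Add | Sub | Mult | Div

datatype com =
    Skip
  | Assign addr binop operand operand
  | Read addr
  | Write operand
  | Seq com com
  | Cond operand com com
  | While operand com

definition bits :: "nat \<Rightarrow> nat" where
  "bits n = max 1 (floorlog 2 n)"

type_synonym store = "nat \<Rightarrow> nat"

fun loc :: "store \<Rightarrow> addr \<Rightarrow> nat" where
  "loc s (Dir i) = i"
| "loc s (Ind i) = s i"

fun addr_cost :: "store \<Rightarrow> addr \<Rightarrow> nat" where
  "addr_cost s (Dir i) = bits i"
| "addr_cost s (Ind i) = bits i + bits (s i)"

fun operand_val :: "store \<Rightarrow> operand \<Rightarrow> nat" where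
  "operand_val s (Const n) = n"
| "operand_val s (At r) = s (loc s r)"

fun operand_cost :: "store \<Rightarrow> operand \<Rightarrow> nat" where
  "operand_cost s (Const n) = bits n"
| "operand_cost s (At r) = addr_cost s r + bits (s (loc s r))"

fun apply_op :: "binop \<Rightarrow> nat \<Rightarrow> nat \<Rightarrow> nat" where
  "apply_op Add m n = m + n"
| "apply_op Sub m n = m - n"
| "apply_op Mult m n = m * n"
| "apply_op Div m n = m div n"

text \<open>
  A configuration consists of the store, the unread input and the output written so far;
  \<open>exec c \<sigma> t \<sigma>'\<close> means that \<open>c\<close>, started in \<open>\<sigma>\<close>, halts in \<open>\<sigma>'\<close> at cost \<open>t\<close>.
\<close>

type_synonym config = "store \<times> nat list \<times> nat list"

inductive exec :: "com \<Rightarrow> config \<Rightarrow> nat \<Rightarrow> config \<Rightarrow> bool" where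
  Skip: "exec Skip \<sigma> 1 \<sigma>"
| Assign: "w = apply_op f (operand_val s u) (operand_val s v) \<Longrightarrow>
    exec (Assign r f u v) (s, inp, out)
      (1 + operand_cost s u + operand_cost s v + addr_cost s r + bits w)
      (s(loc s r := w), inp, out)"
| Read: "exec (Read r) (s, w # inp, out) (1 + addr_cost s r + bits w) (s(loc s r := w), inp, out)"
| Read_end: "exec (Read r) (s, [], out) (1 + addr_cost s r + bits 0) (s(loc s r := 0), [], out)"
| Write: "exec (Write u) (s, inp, out) (1 + operand_cost s u) (s, inp, out @ [operand_val s u])"
| Seq: "exec c \<sigma> t \<sigma>' \<Longrightarrow> exec d \<sigma>' t' \<sigma>'' \<Longrightarrow> exec (Seq c d) \<sigma> (t + t') \<sigma>''"
| Cond_nonzero: "operand_val s u \<noteq> 0 \<Longrightarrow> exec c (s, inp, out) t \<sigma>' \<Longrightarrow>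
    exec (Cond u c d) (s, inp, out) (1 + operand_cost s u + t) \<sigma>'"
| Cond_zero: "operand_val s u = 0 \<Longrightarrow> exec d (s, inp, out) t \<sigma>' \<Longrightarrow>
    exec (Cond u c d) (s, inp, out) (1 + operand_cost s u + t) \<sigma>'"
| While_zero: "operand_val s u = 0 \<Longrightarrow>
    exec (While u c) (s, inp, out) (1 + operand_cost s u) (s, inp, out)"
| While_nonzero: "operand_val s u \<noteq> 0 \<Longrightarrow> exec c (s, inp, out) t \<sigma>' \<Longrightarrow>
    exec (While u c) \<sigma>' t' \<sigma>'' \<Longrightarrow>
    exec (While u c) (s, inp, out) (1 + operand_cost s u + t + t') \<sigma>''"

definition code_size :: "nat list \<Rightarrow> nat" where
  "code_size ws = (\<Sum>w\<leftarrow>ws. bits w)"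

text \<open>
  The encodings are relations between number sequences and objects: an object may have
  several codes, or none. The program has to work on every code of every object in \<open>D\<close>,
  within one polynomial bound in the size of the code.
\<close>

definition poly_time_computable ::
  "(nat list \<Rightarrow> 'i \<Rightarrow> bool) \<Rightarrow> (nat list \<Rightarrow> 'o \<Rightarrow> bool) \<Rightarrow> ('i \<Rightarrow> bool) \<Rightarrow> ('i \<Rightarrow> 'o) \<Rightarrow> bool" where
  "poly_time_computable enc_in enc_out D T \<longleftrightarrow>
     (\<exists>(c :: com) (p :: nat poly). \<forall>G ws. D G \<and> enc_in ws G \<longrightarrow>
        (\<exists>s inp ws' t. exec c (\<lambda>_. 0, ws, []) t (s, inp, ws') \<and>
           t \<le> poly p (code_size ws) \<and> enc_out ws' (T G)))"

text \<open>
  The explicit encoding of a game: the sizes of the four sets, the table of question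
  probabilities as fractions (not necessarily in lowest terms), and the truth table of the
  predicate. The sets are listed in an arbitrary order and their elements are identified
  with their positions. A game has a code exactly if all question probabilities are
  rational.
\<close>

definition encodes_game :: "nat list \<Rightarrow> ('x, 'y, 'a, 'b) game \<Rightarrow> bool" where
  "encodes_game ws G \<longleftrightarrow>
     (\<exists>xs ys as bs num den.
        distinct xs \<and> set xs = questX G \<and> distinct ys \<and> set ys = questY G \<and>
        distinct as \<and> set as = ansA G \<and> distinct bs \<and> set bs = ansB G \<and>
        (\<forall>x\<in>questX G. \<forall>y\<in>questY G.
           0 < den x y \<and> pmf (qdist G) (x, y) = real (num x y) / real (den x y)) \<and>
        ws = [length xs, length ys, length as, length bs] @
          concat [[num x y, den x y]. x \<leftarrow> xs, y \<leftarrow> ys] @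
          [of_bool (win G a b x y). x \<leftarrow> xs, y \<leftarrow> ys, a \<leftarrow> as, b \<leftarrow> bs])"

end

theory Submission
  imports Defs
begin

text \<open>
  Fix an integer \<open>t \<ge> 1 / \<tau>\<close> and put \<open>K = t |X| |Y|\<close>. Round the question probabilities down to
  multiples \<open>w(x, y) / K\<close>; the weight lost is at most \<open>|X| |Y| / K \<le> \<tau>\<close> and is given to an additional pair
  of questions on which the players always win. Then replace every question by as many copies as its
  row or column sum of \<open>w\<close>, and choose the two copies uniformly and independently given the pair of
  original questions. There are \<open>K\<close> copies on each side, each of probability \<open>1 / K\<close>.

  A strategy for the original game is played on the copies; it wins at least as often since the
  lost weight is now won for free. Conversely, averaging a strategy for the new game over the copies of
  each question is a strategy for the original game, because the winning probability is bilinear in the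
  strategies and the copies are independent; this loses at most \<open>\<tau>\<close>. Only this averaging property
  and the normalization of the correlations matter, so that the classical and the entangled value are
  treated alike.

  The construction is equivariant under reordering the questions, which makes the output of the
  program on any code of the game a code of one and the same game.
\<close>

section \<open>The blow-up of an integer weight matrix\<close>

text \<open>Integer weights could be had exactly from a common denominator of the probabilities.
  That denominator can be exponential in the code size, and so would be the number of copies, all of
  which the output lists. Rounding to multiples of \<open>1 / K\<close> keeps their number
  polynomial at the price of the error \<tau>. The additional pair brings the total weight to
  exactly \<open>K\<close>, so the row sums and the column sums both add up to \<open>K\<close> and
  the two sides receive equally many copies. The two additional questions are asked only together;
  hence the free wins have exactly the lost probability. Two points shape the formal proof. The map
  has to be a function of games, not of codes, and to be defined for irrational probabilities as
  well; so it uses sets, floors and a choice of labels, and the program realizes it for every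
  listing. And an empty answer set turns both values into \<open>Sup {}\<close>, so the two sets of
  correlations have to be empty together; this holds because correlations are transported in both
  directions.\<close>

lemma win_prob_eq_sum:
  assumes "two_player_game G"
  shows "win_prob G P = (\<Sum>x\<in>questX G. \<Sum>y\<in>questY G. pmf (qdist G) (x, y) *
    (\<Sum>a\<in>ansA G. \<Sum>b\<in>ansB G. of_bool (win G a b x y) * P a b x y))"
proof -
  have "win_prob G P = (\<Sum>p\<in>questX G \<times> questY G. pmf (qdist G) p *\<^sub>R
    (case p of (x, y) \<Rightarrow> \<Sum>a\<in>ansA G. \<Sum>b\<in>ansB G. of_bool (win G a b x y) * P a b x y))"
    unfolding win_prob_def using assms
    by (intro integral_measure_pmf) (auto simp: two_player_game_def)
  then show ?thesis by (simp add: sum.cartesian_product case_prod_unfold)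
qed

lemma sum_pmf_questions:
  assumes "two_player_game G"
  shows "(\<Sum>x\<in>questX G. \<Sum>y\<in>questY G. pmf (qdist G) (x, y)) = 1"
  using assms by (simp add: sum.cartesian_product sum_pmf_eq_1 two_player_game_def)

lemma questions_nonempty:
  assumes "two_player_game G"
  shows "questX G \<noteq> {}" "questY G \<noteq> {}"
  using assms set_pmf_not_empty[of "qdist G"] by (auto simp: two_player_game_def)

lemma pmf_map_fst_finite:
  assumes "set_pmf p \<subseteq> A \<times> B" "finite B"
  shows "pmf (map_pmf fst p) u = (\<Sum>v\<in>B. pmf p (u, v))"
proof -
  have "fst -` {u} \<inter> set_pmf p = ({u} \<times> B) \<inter> set_pmf p" using assms by auto
  then have "measure p (fst -` {u}) = measure p ({u} \<times> B)"
    by (metis measure_Int_set_pmf)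
  then show ?thesis
    using assms sum.cartesian_product[of "\<lambda>u v. pmf p (u, v)" B "{u}"]
    by (simp add: pmf_map measure_measure_pmf_finite)
qed

lemma pmf_map_snd_finite:
  assumes "set_pmf p \<subseteq> A \<times> B" "finite A"
  shows "pmf (map_pmf snd p) v = (\<Sum>u\<in>A. pmf p (u, v))"
proof -
  have "snd -` {v} \<inter> set_pmf p = (A \<times> {v}) \<inter> set_pmf p" using assms by auto
  then have "measure p (snd -` {v}) = measure p (A \<times> {v})"
    by (metis measure_Int_set_pmf)
  then show ?thesis
    using assms sum.cartesian_product[of "\<lambda>u v. pmf p (u, v)" "{v}" A]
    by (simp add: pmf_map measure_measure_pmf_finite)
qed

text \<open>The labels form consecutive blocks: a new element \<open>s\<close> labels the block of
  length \<open>c s\<close> that starts at \<open>sum c S\<close>.\<close>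

lemma ex_labelling:
  fixes c :: "'s \<Rightarrow> nat"
  assumes "finite S"
  shows "\<exists>l. (\<forall>u<sum c S. l u \<in> S) \<and> (\<forall>s\<in>S. card {u. u < sum c S \<and> l u = s} = c s)"
  using assms
proof (induction S)
  case (insert s S)
  then obtain l where l: "\<And>u. u < sum c S \<Longrightarrow> l u \<in> S"
    "\<And>s. s \<in> S \<Longrightarrow> card {u. u < sum c S \<and> l u = s} = c s" by blast
  have ne: "l u \<noteq> s" if "u < sum c S" for u
    using l(1)[OF that] insert.hyps by auto
  define l' where "l' u = (if u < sum c S then l u else s)" for u
  have "{u. u < sum c (insert s S) \<and> l' u = s} = {sum c S..<sum c S + c s}"
    using insert.hyps ne by (auto simp: l'_def split: if_splits)
  moreover have "{u. u < sum c (insert s S) \<and> l' u = r} = {u. u < sum c S \<and> l u = r}" if "r \<in> S" for r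
    using insert.hyps that by (auto simp: l'_def)
  moreover have "l' u \<in> insert s S" for u
    using l(1) by (simp add: l'_def)
  ultimately show ?case
    by (intro exI[of _ l']) (auto simp: l(2) simp del: sum.insert)
qed simp

text \<open>Chosen from the set and the multiplicities alone. Numbering the blocks along a listing
  of \<open>S\<close> would make the game depend on the code it came from.\<close>

definition labelling :: "'s set \<Rightarrow> ('s \<Rightarrow> nat) \<Rightarrow> nat \<Rightarrow> 's" where
  "labelling S c = (SOME l. (\<forall>u<sum c S. l u \<in> S) \<and> (\<forall>s\<in>S. card {u. u < sum c S \<and> l u = s} = c s))"

lemma labelling:
  assumes "finite S"
  shows "u < sum c S \<Longrightarrow> labelling S c u \<in> S"
    and "s \<in> S \<Longrightarrow> card {u. u < sum c S \<and> labelling S c u = s} = c s"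
  using someI_ex[OF ex_labelling[OF assms, of c]] unfolding labelling_def[symmetric] by blast+

locale integer_weights =
  fixes S :: "'s set" and R :: "'r set" and w :: "'s \<Rightarrow> 'r \<Rightarrow> nat"
  assumes finS: "finite S" and finR: "finite R" and total_pos: "0 < (\<Sum>s\<in>S. \<Sum>r\<in>R. w s r)"
begin

definition total :: nat where "total = (\<Sum>s\<in>S. \<Sum>r\<in>R. w s r)"
definition row :: "'s \<Rightarrow> nat" where "row s = (\<Sum>r\<in>R. w s r)"
definition col :: "'r \<Rightarrow> nat" where "col r = (\<Sum>s\<in>S. w s r)"
definition labX :: "nat \<Rightarrow> 's" where "labX = labelling S row"
definition labY :: "nat \<Rightarrow> 'r" where "labY = labelling R col"
definition fibX :: "'s \<Rightarrow> nat set" where "fibX s = {u. u < total \<and> labX u = s}"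
definition fibY :: "'r \<Rightarrow> nat set" where "fibY r = {v. v < total \<and> labY v = r}"

text \<open>Given the questions \<open>s\<close> and \<open>r\<close>, of probability
  \<open>w s r / total\<close>, all \<open>row s * col r\<close> pairs of copies are equally
  likely.\<close>

definition blowup :: "(nat \<times> nat) pmf" where
  "blowup = embed_pmf (\<lambda>(u, v). if u < total \<and> v < total
     then w (labX u) (labY v) / (real total * real (row (labX u)) * real (col (labY v))) else 0)"

lemma sum_row: "sum row S = total"
  by (simp add: total_def row_def)

lemma sum_col: "sum col R = total"
  unfolding total_def col_def by (rule sum.swap)

lemma labX_in: "u < total \<Longrightarrow> labX u \<in> S"
  using labelling(1)[OF finS, of u row] by (simp add: sum_row labX_def)

lemma labY_in: "v < total \<Longrightarrow> labY v \<in> R"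
  using labelling(1)[OF finR, of v col] by (simp add: sum_col labY_def)

lemma card_fibX: "s \<in> S \<Longrightarrow> card (fibX s) = row s"
  using labelling(2)[OF finS, of s row] by (simp add: sum_row labX_def fibX_def)

lemma card_fibY: "r \<in> R \<Longrightarrow> card (fibY r) = col r"
  using labelling(2)[OF finR, of r col] by (simp add: sum_col labY_def fibY_def)

lemma finite_fib [simp]: "finite (fibX s)" "finite (fibY r)"
  by (simp_all add: fibX_def fibY_def)

lemma row_pos: "u < total \<Longrightarrow> 0 < row (labX u)"
  using card_fibX[OF labX_in, of u] card_gt_0_iff[of "fibX (labX u)"] by (auto simp: fibX_def)

lemma col_pos: "v < total \<Longrightarrow> 0 < col (labY v)"
  using card_fibY[OF labY_in, of v] card_gt_0_iff[of "fibY (labY v)"] by (auto simp: fibY_def)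

lemma weight_le_row: "r \<in> R \<Longrightarrow> w s r \<le> row s"
  unfolding row_def by (rule member_le_sum) (auto simp: finR)

lemma weight_le_col: "s \<in> S \<Longrightarrow> w s r \<le> col r"
  unfolding col_def by (rule member_le_sum) (auto simp: finS)

lemma sum_labX: "(\<Sum>u<total. f u) = (\<Sum>s\<in>S. \<Sum>u\<in>fibX s. f u)"
  using sum.group[of "{..<total}" S labX f] labX_in finS by (auto simp: fibX_def image_subset_iff)

lemma sum_labY: "(\<Sum>v<total. f v) = (\<Sum>r\<in>R. \<Sum>v\<in>fibY r. f v)"
  using sum.group[of "{..<total}" R labY f] labY_in finR by (auto simp: fibY_def image_subset_iff)

text \<open>Summing over the \<open>col r\<close> copies of \<open>r\<close> cancels the factor
  \<open>col r\<close>; summing \<open>w s r\<close> over \<open>r\<close> then cancels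
  \<open>row s\<close>.\<close>

lemma marginalX:
  assumes "s \<in> S" "0 < row s"
  shows "(\<Sum>v<total. w s (labY v) / (real total * real (row s) * real (col (labY v)))) = 1 / real total"
proof -
  have "(\<Sum>v<total. w s (labY v) / (real total * real (row s) * real (col (labY v)))) =
      (\<Sum>r\<in>R. \<Sum>v\<in>fibY r. w s r / (real total * real (row s) * real (col r)))"
    unfolding sum_labY by (intro sum.cong refl) (simp add: fibY_def)
  also have "\<dots> = (\<Sum>r\<in>R. w s r / (total * row s))"
  proof (rule sum.cong[OF refl])
    fix r assume "r \<in> R"
    \<comment> \<open>If \<open>col r = 0\<close>, the fibre is empty and the left side vanishes; so
      does the right side, because \<open>w s r\<close> is bounded by \<open>col r\<close>.\<close>
    then show "(\<Sum>v\<in>fibY r. w s r / (real total * real (row s) * real (col r))) = w s r / (total * row s)"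
      using weight_le_col[OF assms(1), of r] by (cases "col r = 0") (auto simp: card_fibY)
  qed
  also have "\<dots> = row s / (total * row s)"
    unfolding sum_divide_distrib[symmetric] of_nat_sum[symmetric] row_def[symmetric] ..
  also have "\<dots> = 1 / total"
    using assms(2) by simp
  finally show ?thesis .
qed

lemma marginalY:
  assumes "r \<in> R" "0 < col r"
  shows "(\<Sum>u<total. w (labX u) r / (real total * real (row (labX u)) * real (col r))) = 1 / real total"
proof -
  have "(\<Sum>u<total. w (labX u) r / (real total * real (row (labX u)) * real (col r))) =
      (\<Sum>s\<in>S. \<Sum>u\<in>fibX s. w s r / (real total * real (row s) * real (col r)))"
    unfolding sum_labX by (intro sum.cong refl) (simp add: fibX_def)
  also have "\<dots> = (\<Sum>s\<in>S. w s r / (total * col r))"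
  proof (rule sum.cong[OF refl])
    fix s assume "s \<in> S"
    then show "(\<Sum>u\<in>fibX s. w s r / (real total * real (row s) * real (col r))) = w s r / (total * col r)"
      using weight_le_row[OF assms(1), of s] by (cases "row s = 0") (auto simp: card_fibX)
  qed
  also have "\<dots> = col r / (total * col r)"
    unfolding sum_divide_distrib[symmetric] of_nat_sum[symmetric] col_def[symmetric] ..
  also have "\<dots> = 1 / total"
    using assms(2) by simp
  finally show ?thesis .
qed

text \<open>The defining function has total mass 1 because its sums over \<open>v\<close> are
  already known to be \<open>1 / total\<close>.\<close>

lemma pmf_blowup: "pmf blowup (u, v) = (if u < total \<and> v < total
     then w (labX u) (labY v) / (real total * real (row (labX u)) * real (col (labY v))) else 0)"
proof -
  let ?f = "\<lambda>(u, v). if u < total \<and> v < total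
     then w (labX u) (labY v) / (real total * real (row (labX u)) * real (col (labY v))) else (0 :: real)"
  have "(\<integral>\<^sup>+ p. ennreal (?f p) \<partial>count_space UNIV) = (\<Sum>p\<in>{..<total} \<times> {..<total}. ennreal (?f p))"
    by (intro nn_integral_count_space') (auto split: if_splits)
  also have "\<dots> = ennreal (\<Sum>p\<in>{..<total} \<times> {..<total}. ?f p)"
    by (intro sum_ennreal) auto
  also have "(\<Sum>p\<in>{..<total} \<times> {..<total}. ?f p) = (\<Sum>u<total. \<Sum>v<total. ?f (u, v))"
    by (simp only: sum.cartesian_product) (auto intro: sum.cong)
  also have "\<dots> = (\<Sum>u<total. 1 / real total)"
    by (intro sum.cong refl) (simp add: marginalX labX_in row_pos)
  also have "\<dots> = 1" using total_pos unfolding total_def[symmetric] by simp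
  finally have "(\<integral>\<^sup>+ p. ennreal (?f p) \<partial>count_space UNIV) = 1" by simp
  then have "pmf blowup (u, v) = ?f (u, v)"
    unfolding blowup_def by (intro pmf_embed_pmf) auto
  then show ?thesis by simp
qed

lemma set_blowup: "set_pmf blowup \<subseteq> {..<total} \<times> {..<total}"
  by (auto simp: set_pmf_eq pmf_blowup split: if_splits)

lemma map_fst_blowup: "map_pmf fst blowup = pmf_of_set {..<total}"
proof (rule pmf_eqI)
  fix u
  have "pmf (map_pmf fst blowup) u = (\<Sum>v<total. pmf blowup (u, v))"
    by (rule pmf_map_fst_finite[OF set_blowup]) simp
  also have "\<dots> = (if u < total then 1 / total else 0)"
    by (simp add: pmf_blowup marginalX labX_in row_pos)
  finally show "pmf (map_pmf fst blowup) u = pmf (pmf_of_set {..<total}) u"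
    using total_pos by (auto simp: total_def[symmetric] indicator_def lessThan_empty_iff)
qed

lemma map_snd_blowup: "map_pmf snd blowup = pmf_of_set {..<total}"
proof (rule pmf_eqI)
  fix v
  have "pmf (map_pmf snd blowup) v = (\<Sum>u<total. pmf blowup (u, v))"
    by (rule pmf_map_snd_finite[OF set_blowup]) simp
  also have "\<dots> = (if v < total then 1 / total else 0)"
    by (simp add: pmf_blowup marginalY labY_in col_pos)
  finally show "pmf (map_pmf snd blowup) v = pmf (pmf_of_set {..<total}) v"
    using total_pos by (auto simp: total_def[symmetric] indicator_def lessThan_empty_iff)
qed

text \<open>The predicate sees the copies through their labels only, so on each pair of fibres it
  can be pulled out, and the correlation is replaced by its average. If a fibre is empty, division
  by 0 makes both sides vanish there.\<close>

lemma blowup_expectation: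
  "(\<Sum>u<total. \<Sum>v<total. pmf blowup (u, v) * (\<Sum>a\<in>A. \<Sum>b\<in>B. of_bool (V a b (labX u) (labY v)) * P a b u v)) =
   (\<Sum>s\<in>S. \<Sum>r\<in>R. w s r / total * (\<Sum>a\<in>A. \<Sum>b\<in>B. of_bool (V a b s r) *
      ((\<Sum>u\<in>fibX s. \<Sum>v\<in>fibY r. P a b u v) / (real (card (fibX s)) * real (card (fibY r))))))" (is "?l = ?r")
proof -
  let ?g = "\<lambda>s r u v. w s r / (real total * real (row s) * real (col r)) * (\<Sum>a\<in>A. \<Sum>b\<in>B. of_bool (V a b s r) * P a b u v)"
  let ?h = "\<lambda>u v. pmf blowup (u, v) * (\<Sum>a\<in>A. \<Sum>b\<in>B. of_bool (V a b (labX u) (labY v)) * P a b u v)"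
  have "?l = (\<Sum>u<total. \<Sum>r\<in>R. \<Sum>v\<in>fibY r. ?h u v)"
    by (intro sum.cong refl sum_labY)
  also have "\<dots> = (\<Sum>s\<in>S. \<Sum>u\<in>fibX s. \<Sum>r\<in>R. \<Sum>v\<in>fibY r. ?h u v)"
    by (rule sum_labX)
  also have "\<dots> = (\<Sum>s\<in>S. \<Sum>u\<in>fibX s. \<Sum>r\<in>R. \<Sum>v\<in>fibY r. ?g s r u v)"
    by (intro sum.cong refl) (auto simp: pmf_blowup fibX_def fibY_def)
  also have "\<dots> = (\<Sum>s\<in>S. \<Sum>r\<in>R. \<Sum>u\<in>fibX s. \<Sum>v\<in>fibY r. ?g s r u v)"
    by (intro sum.cong refl sum.swap)
  also have "\<dots> = ?r"
  proof (intro sum.cong refl)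
    fix s r assume sr: "s \<in> S" "r \<in> R"
    have "(\<Sum>u\<in>fibX s. \<Sum>v\<in>fibY r. \<Sum>a\<in>A. \<Sum>b\<in>B. of_bool (V a b s r) * P a b u v) =
        (\<Sum>u\<in>fibX s. \<Sum>a\<in>A. \<Sum>v\<in>fibY r. \<Sum>b\<in>B. of_bool (V a b s r) * P a b u v)"
      by (intro sum.cong refl sum.swap)
    also have "\<dots> = (\<Sum>a\<in>A. \<Sum>u\<in>fibX s. \<Sum>v\<in>fibY r. \<Sum>b\<in>B. of_bool (V a b s r) * P a b u v)"
      by (rule sum.swap)
    also have "\<dots> = (\<Sum>a\<in>A. \<Sum>u\<in>fibX s. \<Sum>b\<in>B. \<Sum>v\<in>fibY r. of_bool (V a b s r) * P a b u v)"
      by (intro sum.cong refl sum.swap)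
    also have "\<dots> = (\<Sum>a\<in>A. \<Sum>b\<in>B. \<Sum>u\<in>fibX s. \<Sum>v\<in>fibY r. of_bool (V a b s r) * P a b u v)"
      by (intro sum.cong refl sum.swap)
    finally have swap: "(\<Sum>u\<in>fibX s. \<Sum>v\<in>fibY r. \<Sum>a\<in>A. \<Sum>b\<in>B. of_bool (V a b s r) * P a b u v) =
      (\<Sum>a\<in>A. \<Sum>b\<in>B. of_bool (V a b s r) * (\<Sum>u\<in>fibX s. \<Sum>v\<in>fibY r. P a b u v))"
      by (simp only: sum_distrib_left)
    have "(\<Sum>u\<in>fibX s. \<Sum>v\<in>fibY r. ?g s r u v) = w s r / (real total * real (row s) * real (col r)) *
        (\<Sum>a\<in>A. \<Sum>b\<in>B. of_bool (V a b s r) * (\<Sum>u\<in>fibX s. \<Sum>v\<in>fibY r. P a b u v))"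
      by (simp only: swap sum_distrib_left[symmetric])
    also have "\<dots> = w s r / total * (\<Sum>a\<in>A. \<Sum>b\<in>B. of_bool (V a b s r) *
        ((\<Sum>u\<in>fibX s. \<Sum>v\<in>fibY r. P a b u v) / (real (card (fibX s)) * real (card (fibY r)))))"
      using sr by (simp add: card_fibX card_fibY mult_ac flip: sum_divide_distrib)
    finally show "(\<Sum>u\<in>fibX s. \<Sum>v\<in>fibY r. ?g s r u v) = w s r / total * (\<Sum>a\<in>A. \<Sum>b\<in>B. of_bool (V a b s r) *
        ((\<Sum>u\<in>fibX s. \<Sum>v\<in>fibY r. P a b u v) / (real (card (fibX s)) * real (card (fibY r)))))" .
  qed
  finally show ?thesis .
qed

end

section \<open>Quadratic forms on a tensor square\<close>

text \<open>On the vector with entries \<open>s\<close> at \<open>n\<close> and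
  \<open>- a i n\<close> at \<open>i\<close>, the form equals |a i n|^2 (Re (a i i) - 2 s). This is
  linear in \<open>s\<close>, hence unbounded below unless \<open>a i n = 0\<close>.\<close>

lemma Re_quadratic_form_two_points:
  fixes a :: "nat \<Rightarrow> nat \<Rightarrow> complex"
  assumes "i < n" "a n n = 0" "a n i = cnj (a i n)"
    and pos: "\<And>v. 0 \<le> Re (\<Sum>i<Suc n. \<Sum>j<Suc n. cnj (v i) * a i j * v j)"
  shows "a i n = 0"
proof (rule ccontr)
  assume "a i n \<noteq> 0"
  define z where "z = a i n"
  define r where "r = Re (a i i)"
  have norm_z: "(cmod z)\<^sup>2 = Re z * Re z + Im z * Im z"
    by (simp add: cmod_power2 flip: power2_eq_square)
  have "0 \<le> (cmod z)\<^sup>2 * (r - 2 * s)" for s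
  proof -
    define v where "v j = (if j = n then of_real s else if j = i then - z else 0)" for j
    have v: "(\<Sum>j<Suc n. f j * v j) = f n * of_real s - f i * z" for f
    proof -
      have "(\<Sum>j<n. f j * v j) = (\<Sum>j<n. if j = i then - (f j * z) else 0)"
        by (intro sum.cong) (auto simp: v_def)
      then show ?thesis using \<open>i < n\<close> by (simp add: v_def)
    qed
    have v': "(\<Sum>j<Suc n. cnj (v j) * f j) = of_real s * f n - cnj z * f i" for f
    proof -
      have "(\<Sum>j<n. cnj (v j) * f j) = (\<Sum>j<n. if j = i then - (cnj z * f j) else 0)"
        by (intro sum.cong) (auto simp: v_def)
      then show ?thesis using \<open>i < n\<close> by (simp add: v_def)
    qed
    have "(\<Sum>i<Suc n. \<Sum>j<Suc n. cnj (v i) * a i j * v j) =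
        (\<Sum>i<Suc n. cnj (v i) * (\<Sum>j<Suc n. a i j * v j))"
      by (simp only: sum_distrib_left mult.assoc)
    also have "\<dots> = of_real s * (- (cnj z * z)) - cnj z * (z * of_real s - a i i * z)"
      unfolding v v' using assms by (simp add: z_def)
    also have "Re \<dots> = (cmod z)\<^sup>2 * (r - 2 * s)"
      by (simp add: r_def norm_z algebra_simps)
    finally show ?thesis using pos[of v] by simp
  qed
  \<comment> \<open>The value \<open>s = (r + 1) / 2\<close> turns \<open>r - 2 * s\<close> into
    -1.\<close>
  moreover have "(cmod z)\<^sup>2 * (r - 2 * ((r + 1) / 2)) = - (cmod z)\<^sup>2"
    by (simp add: field_simps)
  ultimately have "(cmod z)\<^sup>2 \<le> 0" by (metis neg_0_le_iff_le)
  then show False using \<open>a i n \<noteq> 0\<close> by (simp add: z_def)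
qed

text \<open>One step of the Cholesky factorization splits off the last row and passes to the Schur complement.\<close>

lemma positive_form_decomposition:
  fixes a :: "nat \<Rightarrow> nat \<Rightarrow> complex"
  assumes "\<And>i j. i < n \<Longrightarrow> j < n \<Longrightarrow> a j i = cnj (a i j)"
    and "\<And>v. 0 \<le> Re (\<Sum>i<n. \<Sum>j<n. cnj (v i) * a i j * v j)"
  shows "\<exists>w. \<forall>i<n. \<forall>j<n. a i j = (\<Sum>k<n. w k i * cnj (w k j))"
  using assms
proof (induction n arbitrary: a)
  case 0
  then show ?case by simp
next
  case (Suc n)
  define \<alpha> where "\<alpha> = Re (a n n)"
  have "a n n = cnj (a n n)" using Suc.prems(1) by blast
  then have ann: "a n n = of_real \<alpha>"
    by (simp add: \<alpha>_def complex_eq_iff)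
  have expand: "(\<Sum>i<Suc n. \<Sum>j<Suc n. cnj (v i) * a i j * v j) =
      (\<Sum>i<n. \<Sum>j<n. cnj (v i) * a i j * v j) + cnj (\<Sum>j<n. a n j * v j) * v n +
      cnj (v n) * (\<Sum>j<n. a n j * v j) + \<alpha> * (cnj (v n) * v n)" for v
  proof -
    have "(\<Sum>i<n. cnj (v i) * a i n * v n) = cnj (\<Sum>j<n. a n j * v j) * v n"
      unfolding cnj_sum sum_distrib_right
      by (intro sum.cong refl) (simp add: Suc.prems(1)[of n])
    moreover have "(\<Sum>j<n. cnj (v n) * a n j * v j) = cnj (v n) * (\<Sum>j<n. a n j * v j)"
      by (simp only: sum_distrib_left mult.assoc)
    moreover have "cnj (v n) * a n n * v n = \<alpha> * (cnj (v n) * v n)"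
      by (simp add: ann)
    ultimately show ?thesis
      by (simp only: sum.lessThan_Suc sum.distrib add_ac)
  qed
  have "0 \<le> \<alpha>"
    using Suc.prems(2)[of "\<lambda>i. if i = n then 1 else 0"] unfolding expand by simp
  \<comment> \<open>With a zero pivot nothing can be divided out; but then the last column vanishes,
    \<open>b\<close> is 0, and the Schur complement is \<open>a\<close> itself.\<close>
  have zero: "a i n = 0" if "i < n" "\<alpha> = 0" for i
  proof (rule Re_quadratic_form_two_points[OF \<open>i < n\<close> _ _ Suc.prems(2)])
    show "a n n = 0" using ann that by simp
    show "a n i = cnj (a i n)" using Suc.prems(1)[of i n] that by simp
  qed
  define b where "b i = a i n / of_real (sqrt \<alpha>)" for i
  define a' where "a' i j = a i j - b i * cnj (b j)" for i j
  have sq: "complex_of_real (sqrt \<alpha>) * complex_of_real (sqrt \<alpha>) = of_real \<alpha>"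
    using \<open>0 \<le> \<alpha>\<close> by (metis of_real_mult real_sqrt_mult_self abs_of_nonneg)
  have "\<exists>w. \<forall>i<n. \<forall>j<n. a' i j = (\<Sum>k<n. w k i * cnj (w k j))"
  proof (rule Suc.IH)
    fix i j assume "i < n" "j < n"
    then show "a' j i = cnj (a' i j)"
      using Suc.prems(1)[of i j] by (simp add: a'_def)
  next
    fix v
    define \<sigma> where "\<sigma> = (\<Sum>j<n. a n j * v j)"
    \<comment> \<open>For a positive pivot this last entry minimizes the form with the other entries
      fixed, and the minimum is the form of the Schur complement. For \<open>\<alpha> = 0\<close>
      the quotient is 0.\<close>
    define v' where "v' = v(n := - \<sigma> / of_real \<alpha>)"
    have s: "(\<Sum>j<n. cnj (b j) * v j) = \<sigma> / of_real (sqrt \<alpha>)"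
      unfolding \<sigma>_def sum_divide_distrib
      by (intro sum.cong refl) (simp add: b_def Suc.prems(1)[of _ n])
    have s': "(\<Sum>j<n. cnj (v j) * b j) = cnj \<sigma> / of_real (sqrt \<alpha>)"
      using arg_cong[OF s, of cnj] by (simp add: mult.commute)
    have "(\<Sum>i<n. \<Sum>j<n. cnj (v i) * a' i j * v j) =
        (\<Sum>i<n. \<Sum>j<n. cnj (v i) * a i j * v j) -
        (\<Sum>i<n. cnj (v i) * b i) * (\<Sum>j<n. cnj (b j) * v j)"
    proof -
      have "cnj (v i) * a' i j * v j = cnj (v i) * a i j * v j - cnj (v i) * b i * (cnj (b j) * v j)" for i j
        by (simp add: a'_def algebra_simps)
      then show ?thesis by (simp only: sum_subtractf sum_product)
    qed
    also have "\<dots> = (\<Sum>i<n. \<Sum>j<n. cnj (v i) * a i j * v j) - cnj \<sigma> * \<sigma> / of_real \<alpha>"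
      unfolding s s' by (simp add: sq)
    also have "\<dots> = (\<Sum>i<Suc n. \<Sum>j<Suc n. cnj (v' i) * a i j * v' j)"
    proof -
      have "(\<Sum>j<n. a n j * v' j) = \<sigma>"
        "(\<Sum>i<n. \<Sum>j<n. cnj (v' i) * a i j * v' j) = (\<Sum>i<n. \<Sum>j<n. cnj (v i) * a i j * v j)"
        by (simp_all add: v'_def \<sigma>_def)
      moreover have "v' n = - \<sigma> / of_real \<alpha>" by (simp add: v'_def)
      ultimately show ?thesis
        unfolding expand by (cases "\<alpha> = 0") simp_all
    qed
    finally show "0 \<le> Re (\<Sum>i<n. \<Sum>j<n. cnj (v i) * a' i j * v j)"
      using Suc.prems(2)[of v'] by simp
  qed
  then obtain w where w: "\<And>i j. i < n \<Longrightarrow> j < n \<Longrightarrow> a' i j = (\<Sum>k<n. w k i * cnj (w k j))"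
    by blast
  \<comment> \<open>The new vector has number \<open>n\<close>; the earlier ones are extended by a
    last entry 0.\<close>
  define w' where "w' k i = (if k = n then (if i = n then of_real (sqrt \<alpha>) else b i)
      else if i = n then 0 else w k i)" for k i
  have w': "(\<Sum>k<n. w' k i * cnj (w' k j)) = (if i = n \<or> j = n then 0 else \<Sum>k<n. w k i * cnj (w k j))" for i j
    by (auto simp: w'_def intro!: sum.neutral sum.cong)
  have "a i j = (\<Sum>k<Suc n. w' k i * cnj (w' k j))" if "i < Suc n" "j < Suc n" for i j
  proof -
    have bn: "b i * complex_of_real (sqrt \<alpha>) = a i n" if "i < n" for i
      using zero[OF that] by (auto simp: b_def)
    consider "i < n" "j < n" | "i < n" "j = n" | "i = n" "j < n" | "i = n" "j = n"
      using \<open>i < Suc n\<close> \<open>j < Suc n\<close> by linarith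
    then show ?thesis
    proof cases
      case 1
      then show ?thesis using w[of i j] by (simp add: w') (simp add: w'_def a'_def algebra_simps)
    next
      case 2
      then show ?thesis by (simp add: w') (simp add: w'_def bn)
    next
      case 3
      then show ?thesis using arg_cong[OF bn[of j], of cnj] Suc.prems(1)[of j n]
        by (simp add: w') (simp add: w'_def mult.commute)
    next
      case 4
      then show ?thesis by (simp add: w') (simp add: w'_def ann sq)
    qed
  qed
  then show ?case by blast
qed

text \<open>The bracket of \<open>f\<close> \<otimes> \<open>g\<close> at \<psi> in coordinates.
  Functions of index pairs in place of matrices make it bilinear without side conditions on
  dimensions.\<close>

definition tensor_form :: "nat \<Rightarrow> complex vec \<Rightarrow> (nat \<times> nat \<Rightarrow> complex) \<Rightarrow> (nat \<times> nat \<Rightarrow> complex) \<Rightarrow> complex" where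
  "tensor_form d \<psi> f g =
     (\<Sum>i<d. \<Sum>k<d. \<Sum>j<d. \<Sum>l<d. f (i, j) * g (k, l) * \<psi> $ (j * d + l) * cnj (\<psi> $ (i * d + k)))"

lemma sum_tensor_index:
  "(\<Sum>r<d * d. h r) = (\<Sum>i<d. \<Sum>k<d. h (i * d + k))" for d :: nat
proof -
  have "(\<Sum>k<d. h (i * d + k)) = sum h {i * d..<i * d + d}" for i
    by (rule sum.reindex_bij_witness[of _ "\<lambda>r. r - i * d" "\<lambda>k. i * d + k"]) auto
  then show ?thesis by (simp add: sum.nat_group)
qed

lemma kron_tensor_form:
  assumes "A \<in> carrier_mat d d" "B \<in> carrier_mat d d" "\<psi> \<in> carrier_vec (d * d)"
  shows "(kron A B *\<^sub>v \<psi>) \<bullet>c \<psi> = tensor_form d \<psi> (($$) A) (($$) B)"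
proof -
  have "(kron A B *\<^sub>v \<psi>) \<bullet>c \<psi> = (\<Sum>r<d * d. (\<Sum>s<d * d. kron A B $$ (r, s) * \<psi> $ s) * cnj (\<psi> $ r))"
    using assms by (auto simp: scalar_prod_def kron_def atLeast0LessThan intro!: sum.cong)
  also have "\<dots> = (\<Sum>r<d * d. \<Sum>s<d * d. A $$ (r div d, s div d) * B $$ (r mod d, s mod d) * \<psi> $ s * cnj (\<psi> $ r))"
    using assms by (auto simp: sum_distrib_right kron_def intro!: sum.cong)
  also have "\<dots> = tensor_form d \<psi> (($$) A) (($$) B)"
    unfolding sum_tensor_index tensor_form_def by (intro sum.cong refl) auto
  finally show ?thesis .
qed

lemma tensor_form_cong:
  assumes "\<And>i j. i < d \<Longrightarrow> j < d \<Longrightarrow> f (i, j) = f' (i, j)" "\<And>i j. i < d \<Longrightarrow> j < d \<Longrightarrow> g (i, j) = g' (i, j)"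
  shows "tensor_form d \<psi> f g = tensor_form d \<psi> f' g'"
  unfolding tensor_form_def by (intro sum.cong refl) (simp add: assms)

lemma tensor_form_0: "tensor_form d \<psi> (\<lambda>p. 0) g = 0" "tensor_form d \<psi> f (\<lambda>p. 0) = 0"
  by (simp_all add: tensor_form_def)

lemma tensor_form_add:
  "tensor_form d \<psi> (\<lambda>p. f p + f' p) g = tensor_form d \<psi> f g + tensor_form d \<psi> f' g"
  "tensor_form d \<psi> f (\<lambda>p. g p + g' p) = tensor_form d \<psi> f g + tensor_form d \<psi> f g'"
  by (simp_all add: tensor_form_def distrib_left distrib_right sum.distrib)

lemma tensor_form_divide:
  "tensor_form d \<psi> (\<lambda>p. f p / c) g = tensor_form d \<psi> f g / c"
  "tensor_form d \<psi> f (\<lambda>p. g p / c) = tensor_form d \<psi> f g / c"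
  by (simp_all add: tensor_form_def sum_divide_distrib)

lemma tensor_form_sum:
  "tensor_form d \<psi> (\<lambda>p. \<Sum>x\<in>S. h x p) g = (\<Sum>x\<in>S. tensor_form d \<psi> (h x) g)"
  "tensor_form d \<psi> f (\<lambda>p. \<Sum>x\<in>S. h x p) = (\<Sum>x\<in>S. tensor_form d \<psi> f (h x))"
  by (induction S rule: infinite_finite_induct) (simp_all add: tensor_form_0 tensor_form_add)

lemma tensor_form_id:
  assumes "\<psi> \<in> carrier_vec (d * d)"
  shows "tensor_form d \<psi> (\<lambda>(i, j). of_bool (i = j)) (\<lambda>(i, j). of_bool (i = j)) = \<psi> \<bullet>c \<psi>"
proof -
  have "(\<Sum>j<d. \<Sum>l<d. of_bool (i = j) * of_bool (k = l) * \<psi> $ (j * d + l) * cnj (\<psi> $ (i * d + k))) =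
      \<psi> $ (i * d + k) * cnj (\<psi> $ (i * d + k))" if "i < d" "k < d" for i k
  proof -
    have "(\<Sum>l<d. of_bool (i = j) * of_bool (k = l) * \<psi> $ (j * d + l) * cnj (\<psi> $ (i * d + k))) =
        (if j = i then \<psi> $ (j * d + k) * cnj (\<psi> $ (i * d + k)) else 0)" for j
    proof -
      have "(\<Sum>l<d. of_bool (i = j) * of_bool (k = l) * \<psi> $ (j * d + l) * cnj (\<psi> $ (i * d + k))) =
        (\<Sum>l<d. if l = k then of_bool (i = j) * \<psi> $ (j * d + k) * cnj (\<psi> $ (i * d + k)) else 0)"
        by (intro sum.cong) auto
      then show ?thesis using that by simp
    qed
    then show ?thesis using that by simp
  qed
  then have "tensor_form d \<psi> (\<lambda>(i, j). of_bool (i = j)) (\<lambda>(i, j). of_bool (i = j)) =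
      (\<Sum>i<d. \<Sum>k<d. \<psi> $ (i * d + k) * cnj (\<psi> $ (i * d + k)))"
    unfolding tensor_form_def by simp
  also have "\<dots> = \<psi> \<bullet>c \<psi>"
    using assms sum_tensor_index[of "\<lambda>r. \<psi> $ r * cnj (\<psi> $ r)" d]
    by (simp add: scalar_prod_def atLeast0LessThan)
  finally show ?thesis .
qed

lemma psd_form_nonneg:
  assumes "psd d M"
  shows "0 \<le> Re (\<Sum>i<d. \<Sum>j<d. cnj (v i) * M $$ (i, j) * v j)"
proof -
  have M: "M \<in> carrier_mat d d" using assms by (simp add: psd_def)
  have "(M *\<^sub>v vec d v) \<bullet>c vec d v = (\<Sum>i<d. \<Sum>j<d. cnj (v i) * M $$ (i, j) * v j)"
    using M by (auto simp: scalar_prod_def atLeast0LessThan sum_distrib_left mult_ac intro!: sum.cong)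
  then show ?thesis using assms by (metis psd_def vec_carrier)
qed

lemma mat_adjoint_index:
  assumes "M \<in> carrier_mat d d" "i < d" "j < d"
  shows "mat_adjoint M $$ (i, j) = cnj (M $$ (j, i))"
  using assms by (auto simp: mat_adjoint_def mat_of_rows_def)

lemma psd_hermitian:
  assumes "psd d M" "i < d" "j < d"
  shows "M $$ (j, i) = cnj (M $$ (i, j))"
  using assms mat_adjoint_index[of M d j i] by (auto simp: psd_def)

lemma psdI:
  assumes M: "M \<in> carrier_mat d d"
    and herm: "\<And>i j. i < d \<Longrightarrow> j < d \<Longrightarrow> M $$ (j, i) = cnj (M $$ (i, j))"
    and pos: "\<And>v. 0 \<le> Re (\<Sum>i<d. \<Sum>j<d. cnj (v i) * M $$ (i, j) * v j)"
  shows "psd d M"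
  unfolding psd_def
proof (intro conjI ballI M)
  have "dim_row (mat_adjoint M) = d" "dim_col (mat_adjoint M) = d"
    using M by (auto simp: mat_adjoint_def)
  then show "mat_adjoint M = M"
    using M by (intro eq_matI) (auto simp: mat_adjoint_index[OF M] herm[symmetric])
  fix v :: "complex vec" assume v: "v \<in> carrier_vec d"
  have "(M *\<^sub>v v) \<bullet>c v = (\<Sum>i<d. \<Sum>j<d. cnj (v $ i) * M $$ (i, j) * v $ j)"
    using M v by (auto simp: scalar_prod_def atLeast0LessThan sum_distrib_left mult_ac intro!: sum.cong)
  then show "0 \<le> Re ((M *\<^sub>v v) \<bullet>c v)" using pos[of "($) v"] by simp
qed

text \<open>It is enough to decompose \<open>A\<close> into rank-one terms: each of them contracts
  the first tensor factor of \<psi> to a vector \<open>\<phi> p\<close>, and what remains is the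
  form of \<open>B\<close> at \<open>\<phi> p\<close>.\<close>

lemma tensor_form_nonneg:
  assumes "psd d A" "psd d B"
  shows "0 \<le> Re (tensor_form d \<psi> (($$) A) (($$) B))"
proof -
  obtain w where w: "\<And>i j. i < d \<Longrightarrow> j < d \<Longrightarrow> A $$ (i, j) = (\<Sum>p<d. w p i * cnj (w p j))"
    using positive_form_decomposition[of d "\<lambda>i j. A $$ (i, j)"]
      psd_hermitian[OF assms(1)] psd_form_nonneg[OF assms(1)] by blast
  define \<phi> where "\<phi> p l = (\<Sum>j<d. cnj (w p j) * \<psi> $ (j * d + l))" for p l
  have "tensor_form d \<psi> (($$) A) (($$) B) = tensor_form d \<psi> (\<lambda>(i, j). \<Sum>p<d. w p i * cnj (w p j)) (($$) B)"
    by (rule tensor_form_cong) (simp_all add: w)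
  also have "\<dots> = (\<Sum>p<d. tensor_form d \<psi> (\<lambda>(i, j). w p i * cnj (w p j)) (($$) B))"
    by (simp add: case_prod_unfold tensor_form_sum)
  also have "\<dots> = (\<Sum>p<d. \<Sum>k<d. \<Sum>l<d. cnj (\<phi> p k) * B $$ (k, l) * \<phi> p l)"
  proof (rule sum.cong[OF refl])
    fix p
    have "tensor_form d \<psi> (\<lambda>(i, j). w p i * cnj (w p j)) (($$) B) =
      (\<Sum>i<d. \<Sum>k<d. \<Sum>j<d. \<Sum>l<d. (w p i * cnj (\<psi> $ (i * d + k))) * B $$ (k, l) * (cnj (w p j) * \<psi> $ (j * d + l)))"
      by (simp add: tensor_form_def mult_ac)
    also have "\<dots> = (\<Sum>k<d. \<Sum>i<d. \<Sum>l<d. \<Sum>j<d. (w p i * cnj (\<psi> $ (i * d + k))) * B $$ (k, l) * (cnj (w p j) * \<psi> $ (j * d + l)))"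
      by (subst sum.swap) (intro sum.cong refl sum.swap)
    also have "\<dots> = (\<Sum>k<d. \<Sum>l<d. \<Sum>i<d. \<Sum>j<d. (w p i * cnj (\<psi> $ (i * d + k))) * B $$ (k, l) * (cnj (w p j) * \<psi> $ (j * d + l)))"
      by (intro sum.cong refl sum.swap)
    also have "\<dots> = (\<Sum>k<d. \<Sum>l<d. cnj (\<phi> p k) * B $$ (k, l) * \<phi> p l)"
    proof (intro sum.cong refl)
      fix k l
      have "cnj (\<phi> p k) = (\<Sum>i<d. w p i * cnj (\<psi> $ (i * d + k)))"
        by (simp add: \<phi>_def)
      then show "(\<Sum>i<d. \<Sum>j<d. (w p i * cnj (\<psi> $ (i * d + k))) * B $$ (k, l) * (cnj (w p j) * \<psi> $ (j * d + l))) =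
          cnj (\<phi> p k) * B $$ (k, l) * \<phi> p l"
        by (simp only: \<phi>_def sum_product[symmetric] sum_distrib_right)
    qed
    finally show "tensor_form d \<psi> (\<lambda>(i, j). w p i * cnj (w p j)) (($$) B) =
      (\<Sum>k<d. \<Sum>l<d. cnj (\<phi> p k) * B $$ (k, l) * \<phi> p l)" .
  qed
  finally have eq: "tensor_form d \<psi> (($$) A) (($$) B) =
      (\<Sum>p<d. \<Sum>k<d. \<Sum>l<d. cnj (\<phi> p k) * B $$ (k, l) * \<phi> p l)" .
  show ?thesis
    unfolding eq by (subst Re_sum) (intro sum_nonneg psd_form_nonneg assms)
qed

lemma psd_average:
  assumes "\<And>x. x \<in> S \<Longrightarrow> psd d (M x)"
  shows "psd d (mat d d (\<lambda>ij. (\<Sum>x\<in>S. M x $$ ij) / of_nat (card S)))"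
proof (rule psdI)
  fix i j assume ij: "i < d" "j < d"
  have "(\<Sum>x\<in>S. M x $$ (j, i)) = cnj (\<Sum>x\<in>S. M x $$ (i, j))"
    unfolding cnj_sum by (intro sum.cong refl psd_hermitian[OF assms] ij)
  then show "mat d d (\<lambda>ij. (\<Sum>x\<in>S. M x $$ ij) / of_nat (card S)) $$ (j, i) =
      cnj (mat d d (\<lambda>ij. (\<Sum>x\<in>S. M x $$ ij) / of_nat (card S)) $$ (i, j))"
    using ij by simp
next
  fix v
  have "(\<Sum>i<d. \<Sum>j<d. cnj (v i) * (mat d d (\<lambda>ij. (\<Sum>x\<in>S. M x $$ ij) / of_nat (card S))) $$ (i, j) * v j) =
      (\<Sum>i<d. \<Sum>j<d. \<Sum>x\<in>S. cnj (v i) * M x $$ (i, j) * v j) / of_nat (card S)"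
    by (simp add: sum_distrib_left sum_distrib_right sum_divide_distrib)
  also have "(\<Sum>i<d. \<Sum>j<d. \<Sum>x\<in>S. cnj (v i) * M x $$ (i, j) * v j) =
      (\<Sum>i<d. \<Sum>x\<in>S. \<Sum>j<d. cnj (v i) * M x $$ (i, j) * v j)"
    by (intro sum.cong refl sum.swap)
  also have "\<dots> = (\<Sum>x\<in>S. \<Sum>i<d. \<Sum>j<d. cnj (v i) * M x $$ (i, j) * v j)"
    by (rule sum.swap)
  finally have eq: "(\<Sum>i<d. \<Sum>j<d. cnj (v i) * (mat d d (\<lambda>ij. (\<Sum>x\<in>S. M x $$ ij) / of_nat (card S))) $$ (i, j) * v j) =
      (\<Sum>x\<in>S. \<Sum>i<d. \<Sum>j<d. cnj (v i) * M x $$ (i, j) * v j) / of_nat (card S)" .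
  have "0 \<le> Re (\<Sum>x\<in>S. \<Sum>i<d. \<Sum>j<d. cnj (v i) * M x $$ (i, j) * v j)"
    by (subst Re_sum) (intro sum_nonneg psd_form_nonneg assms)
  then show "0 \<le> Re (\<Sum>i<d. \<Sum>j<d. cnj (v i) * (mat d d (\<lambda>ij. (\<Sum>x\<in>S. M x $$ ij) / of_nat (card S))) $$ (i, j) * v j)"
    unfolding eq Re_divide_of_nat by simp
qed simp

section \<open>The regularized game and its values\<close>

text \<open>A floor of reals, so that rounding is defined for every game. For a probability given as
  a fraction it is the integer quotient of \<open>K * num\<close> by \<open>den\<close>, which the
  machine computes exactly.\<close>

definition rounded :: "nat \<Rightarrow> ('x, 'y, 'a, 'b) game \<Rightarrow> 'x \<Rightarrow> 'y \<Rightarrow> nat" where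
  "rounded K G x y = nat \<lfloor>real K * pmf (qdist G) (x, y)\<rfloor>"

text \<open>\<^term>\<open>None\<close> is an additional question on which the players win; it takes up the weight lost by rounding.\<close>

fun padded_weight :: "nat \<Rightarrow> ('x, 'y, 'a, 'b) game \<Rightarrow> 'x option \<Rightarrow> 'y option \<Rightarrow> nat" where
  "padded_weight K G (Some x) (Some y) = rounded K G x y"
| "padded_weight K G None None = K - (\<Sum>x\<in>questX G. \<Sum>y\<in>questY G. rounded K G x y)"
| "padded_weight K G _ _ = 0"

fun padded_win :: "('x, 'y, 'a, 'b) game \<Rightarrow> 'a \<Rightarrow> 'b \<Rightarrow> 'x option \<Rightarrow> 'y option \<Rightarrow> bool" where
  "padded_win G a b (Some x) (Some y) = win G a b x y"
| "padded_win G a b _ _ = True"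

definition scale :: "nat \<Rightarrow> ('x, 'y, 'a, 'b) game \<Rightarrow> nat" where
  "scale t G = t * card (questX G) * card (questY G)"

abbreviation padded_questions :: "'x set \<Rightarrow> 'x option set" where
  "padded_questions X \<equiv> insert None (Some ` X)"

definition regularized :: "nat \<Rightarrow> ('x, 'y, 'a, 'b) game \<Rightarrow> (nat, nat, 'a, 'b) game" where
  "regularized t G = (let K = scale t G; S = padded_questions (questX G); R = padded_questions (questY G);
      w = padded_weight K G in
    \<lparr>questX = {..<K}, questY = {..<K}, ansA = ansA G, ansB = ansB G,
     qdist = integer_weights.blowup S R w,
     win = (\<lambda>a b u v. padded_win G a b (integer_weights.labX S R w u) (integer_weights.labY S R w v))\<rparr>)"

type_synonym ('x, 'y, 'a, 'b) correlation = "'a \<Rightarrow> 'b \<Rightarrow> 'x \<Rightarrow> 'y \<Rightarrow> real"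

definition valid_correlations ::
  "'x set \<Rightarrow> 'y set \<Rightarrow> 'a set \<Rightarrow> 'b set \<Rightarrow> ('x, 'y, 'a, 'b) correlation set \<Rightarrow> bool" where
  "valid_correlations X Y A B C \<longleftrightarrow> (\<forall>P\<in>C. \<forall>x\<in>X. \<forall>y\<in>Y.
     (\<forall>a\<in>A. \<forall>b\<in>B. 0 \<le> P a b x y) \<and> (\<Sum>a\<in>A. \<Sum>b\<in>B. P a b x y) = 1)"

text \<open>The players of the second game play the first one with questions drawn uniformly from \<open>S u\<close> and \<open>T v\<close>.\<close>

definition averages_to :: "'x set \<Rightarrow> 'y set \<Rightarrow> 'u set \<Rightarrow> 'v set \<Rightarrow> 'a set \<Rightarrow> 'b set \<Rightarrow>
    ('x, 'y, 'a, 'b) correlation set \<Rightarrow> ('u, 'v, 'a, 'b) correlation set \<Rightarrow> bool" where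
  "averages_to X Y U V A B C C' \<longleftrightarrow> (\<forall>P\<in>C. \<forall>S T.
     (\<forall>u\<in>U. finite (S u) \<and> S u \<noteq> {} \<and> S u \<subseteq> X) \<and> (\<forall>v\<in>V. finite (T v) \<and> T v \<noteq> {} \<and> T v \<subseteq> Y) \<longrightarrow>
     (\<exists>P'\<in>C'. \<forall>u\<in>U. \<forall>v\<in>V. \<forall>a\<in>A. \<forall>b\<in>B.
        P' a b u v = (\<Sum>x\<in>S u. \<Sum>y\<in>T v. P a b x y) / (real (card (S u)) * real (card (T v)))))"

locale rounded_game =
  fixes G :: "('x, 'y, 'a, 'b) game" and t :: nat
  assumes game: "two_player_game G" and t_pos: "0 < t"
begin

definition K :: nat where "K = scale t G"
definition loss :: nat where "loss = padded_weight K G None None"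

lemma finite_sets: "finite (questX G)" "finite (questY G)" "finite (ansA G)" "finite (ansB G)"
  using game by (auto simp: two_player_game_def)

lemma K_pos: "0 < K"
  using t_pos finite_sets questions_nonempty[OF game] by (simp add: K_def scale_def card_gt_0_iff)

lemma rounded_le: "rounded K G x y \<le> real K * pmf (qdist G) (x, y)"
  by (simp add: rounded_def)

lemma rounded_ge: "real K * pmf (qdist G) (x, y) - 1 \<le> rounded K G x y"
proof -
  have "0 \<le> \<lfloor>real K * pmf (qdist G) (x, y)\<rfloor>" by simp
  then show ?thesis unfolding rounded_def by linarith
qed

lemma sum_rounded_le: "(\<Sum>x\<in>questX G. \<Sum>y\<in>questY G. rounded K G x y) \<le> K"
proof -
  have "real (\<Sum>x\<in>questX G. \<Sum>y\<in>questY G. rounded K G x y) \<le>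
      (\<Sum>x\<in>questX G. \<Sum>y\<in>questY G. real K * pmf (qdist G) (x, y))"
    unfolding of_nat_sum by (intro sum_mono rounded_le)
  also have "\<dots> = K"
    using sum_pmf_questions[OF game] by (simp flip: sum_distrib_left)
  finally show ?thesis by (simp only: of_nat_le_iff)
qed

lemma loss_eq: "real loss = real K - (\<Sum>x\<in>questX G. \<Sum>y\<in>questY G. real (rounded K G x y))"
  using sum_rounded_le by (simp add: loss_def of_nat_diff)

lemma loss_le: "real loss \<le> real (card (questX G)) * real (card (questY G))"
proof -
  have "real K - card (questX G) * card (questY G) =
      (\<Sum>x\<in>questX G. \<Sum>y\<in>questY G. real K * pmf (qdist G) (x, y) - 1)"
    using sum_pmf_questions[OF game] by (simp add: sum_subtractf flip: sum_distrib_left)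
  also have "\<dots> \<le> (\<Sum>x\<in>questX G. \<Sum>y\<in>questY G. real (rounded K G x y))"
    by (intro sum_mono rounded_ge)
  finally show ?thesis by (simp add: loss_eq)
qed

lemma loss_ratio_le: "loss / K \<le> 1 / t"
proof -
  have pos: "0 < card (questX G)" "0 < card (questY G)"
    using finite_sets questions_nonempty[OF game] by (simp_all add: card_gt_0_iff)
  have "loss / K \<le> (real (card (questX G)) * real (card (questY G))) / K"
    by (intro divide_right_mono loss_le) simp
  also have "\<dots> = 1 / t"
    using pos t_pos by (simp add: K_def scale_def)
  finally show ?thesis .
qed

abbreviation "pX \<equiv> padded_questions (questX G)"
abbreviation "pY \<equiv> padded_questions (questY G)"

text \<open>Pairs with exactly one additional question have weight 0 and disappear by
  \<open>h 0 s r = 0\<close>.\<close>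

lemma padded_sum:
  fixes h :: "nat \<Rightarrow> 'x option \<Rightarrow> 'y option \<Rightarrow> 'c :: comm_monoid_add"
  assumes "\<And>s r. h 0 s r = 0"
  shows "(\<Sum>s\<in>pX. \<Sum>r\<in>pY. h (padded_weight K G s r) s r) =
    (\<Sum>x\<in>questX G. \<Sum>y\<in>questY G. h (rounded K G x y) (Some x) (Some y)) + h loss None None"
  using finite_sets by (simp add: sum.reindex assms loss_def add.commute)

lemma padded_total: "(\<Sum>s\<in>pX. \<Sum>r\<in>pY. padded_weight K G s r) = K"
  using padded_sum[of "\<lambda>n _ _. n"] sum_rounded_le by (simp add: loss_def)

sublocale integer_weights pX pY "padded_weight K G"
  by unfold_locales (use finite_sets padded_total K_pos in auto)

lemma total_eq: "total = K"
  using padded_total by (simp add: total_def)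

lemma regularized_sel:
  "questX (regularized t G) = {..<K}" "questY (regularized t G) = {..<K}"
  "ansA (regularized t G) = ansA G" "ansB (regularized t G) = ansB G"
  "qdist (regularized t G) = blowup"
  "win (regularized t G) a b u v = padded_win G a b (labX u) (labY v)"
  by (simp_all add: regularized_def Let_def K_def)

lemma game_regularized: "two_player_game (regularized t G)"
  using finite_sets set_blowup by (simp add: two_player_game_def regularized_sel total_eq)

lemma biregular_regularized: "biregular (regularized t G)"
  using map_fst_blowup map_snd_blowup by (simp add: biregular_def regularized_sel total_eq)

text \<open>Division by 0 makes it 0 on questions without copies. It is not normalized there, but
  such questions have weight 0.\<close>

definition fibre_average :: "(nat, nat, 'a, 'b) correlation \<Rightarrow> ('x option, 'y option, 'a, 'b) correlation" where
  "fibre_average P a b s r =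
     (\<Sum>u\<in>fibX s. \<Sum>v\<in>fibY r. P a b u v) / (real (card (fibX s)) * real (card (fibY r)))"

text \<open>The additional pair contributes exactly \<open>loss / K\<close>: every pair of answers
  wins on it, and correlations sum to 1.\<close>

lemma win_prob_regularized:
  assumes valid: "valid_correlations {..<K} {..<K} (ansA G) (ansB G) C" and "P \<in> C"
  shows "win_prob (regularized t G) P =
    (\<Sum>x\<in>questX G. \<Sum>y\<in>questY G. rounded K G x y / K *
      (\<Sum>a\<in>ansA G. \<Sum>b\<in>ansB G. of_bool (win G a b x y) * fibre_average P a b (Some x) (Some y))) + loss / K"
proof -
  have "win_prob (regularized t G) P = (\<Sum>s\<in>pX. \<Sum>r\<in>pY. padded_weight K G s r / K *
      (\<Sum>a\<in>ansA G. \<Sum>b\<in>ansB G. of_bool (padded_win G a b s r) * fibre_average P a b s r))"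
    using blowup_expectation[where A = "ansA G" and B = "ansB G" and V = "padded_win G" and P = P]
    unfolding win_prob_eq_sum[OF game_regularized] regularized_sel fibre_average_def total_eq .
  also have "\<dots> = (\<Sum>x\<in>questX G. \<Sum>y\<in>questY G. rounded K G x y / K *
      (\<Sum>a\<in>ansA G. \<Sum>b\<in>ansB G. of_bool (win G a b x y) * fibre_average P a b (Some x) (Some y))) +
      loss / K * (\<Sum>a\<in>ansA G. \<Sum>b\<in>ansB G. fibre_average P a b None None)"
    by (subst padded_sum[of "\<lambda>n s r. n / K * (\<Sum>a\<in>ansA G. \<Sum>b\<in>ansB G. of_bool (padded_win G a b s r) *
      fibre_average P a b s r)"]) simp_all
  also have "loss / K * (\<Sum>a\<in>ansA G. \<Sum>b\<in>ansB G. fibre_average P a b None None) = loss / K"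
  \<comment> \<open>If \<open>loss = 0\<close>, the fibres of \<open>None\<close> are empty and the
    average sums to 0 instead of 1; the factor \<open>loss / K\<close> is 0 then.\<close>
  proof (cases "loss = 0")
    case False
    have card: "0 < real (card (fibX None))" "0 < real (card (fibY None))"
    proof -
      have "0 < padded_weight K G None None" using False by (simp add: loss_def)
      then have "0 < row None" "0 < col None"
        using less_le_trans[OF _ weight_le_row] less_le_trans[OF _ weight_le_col] by blast+
      then show "0 < real (card (fibX None))" "0 < real (card (fibY None))"
        by (simp_all add: card_fibX card_fibY)
    qed
    have one: "(\<Sum>a\<in>ansA G. \<Sum>b\<in>ansB G. P a b u v) = 1" if "u \<in> fibX None" "v \<in> fibY None" for u v
      using valid that \<open>P \<in> C\<close> by (auto simp: valid_correlations_def fibX_def fibY_def total_eq)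
    have "(\<Sum>a\<in>ansA G. \<Sum>b\<in>ansB G. \<Sum>u\<in>fibX None. \<Sum>v\<in>fibY None. P a b u v) =
        (\<Sum>a\<in>ansA G. \<Sum>u\<in>fibX None. \<Sum>b\<in>ansB G. \<Sum>v\<in>fibY None. P a b u v)"
      by (intro sum.cong refl sum.swap)
    also have "\<dots> = (\<Sum>u\<in>fibX None. \<Sum>a\<in>ansA G. \<Sum>b\<in>ansB G. \<Sum>v\<in>fibY None. P a b u v)"
      by (rule sum.swap)
    also have "\<dots> = (\<Sum>u\<in>fibX None. \<Sum>a\<in>ansA G. \<Sum>v\<in>fibY None. \<Sum>b\<in>ansB G. P a b u v)"
      by (intro sum.cong refl sum.swap)
    also have "\<dots> = (\<Sum>u\<in>fibX None. \<Sum>v\<in>fibY None. \<Sum>a\<in>ansA G. \<Sum>b\<in>ansB G. P a b u v)"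
      by (intro sum.cong refl sum.swap)
    also have "\<dots> = real (card (fibX None)) * real (card (fibY None))"
      by (simp add: one)
    finally have "(\<Sum>a\<in>ansA G. \<Sum>b\<in>ansB G. fibre_average P a b None None) = 1"
      using card unfolding fibre_average_def sum_divide_distrib[symmetric]
      by (metis divide_self mult_eq_0_iff less_irrefl)
    then show ?thesis by simp
  qed simp
  finally show ?thesis .
qed

text \<open>\<open>averages_to\<close> is used in both directions: with singletons it lets every
  copy play its original question, with fibres it lets every question play like a random copy of
  itself. The winning probabilities then share the rounded weights, and the rest is at most
  \<open>loss / K\<close>, hence at most \<open>1 / t\<close>.\<close>

lemma values_close:
  assumes valid: "valid_correlations (questX G) (questY G) (ansA G) (ansB G) C"
    and valid': "valid_correlations {..<K} {..<K} (ansA G) (ansB G) C'"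
    and avg: "averages_to (questX G) (questY G) {..<K} {..<K} (ansA G) (ansB G) C C'"
    and avg': "averages_to {..<K} {..<K} (questX G) (questY G) (ansA G) (ansB G) C' C"
  shows "Sup (win_prob G ` C) \<le> Sup (win_prob (regularized t G) ` C')"
    and "Sup (win_prob (regularized t G) ` C') \<le> Sup (win_prob G ` C) + 1 / t"
proof -
  define val where "val P x y = (\<Sum>a\<in>ansA G. \<Sum>b\<in>ansB G. of_bool (win G a b x y) * P a b x y)"
    for P :: "('x, 'y, 'a, 'b) correlation" and x y
  have val: "0 \<le> val P x y" "val P x y \<le> 1" if "P \<in> C" "x \<in> questX G" "y \<in> questY G" for P x y
  proof -
    have P: "\<And>a b. a \<in> ansA G \<Longrightarrow> b \<in> ansB G \<Longrightarrow> 0 \<le> P a b x y" "(\<Sum>a\<in>ansA G. \<Sum>b\<in>ansB G. P a b x y) = 1"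
      using valid that by (auto simp: valid_correlations_def)
    show "0 \<le> val P x y" unfolding val_def by (intro sum_nonneg mult_nonneg_nonneg P) auto
    have "val P x y \<le> (\<Sum>a\<in>ansA G. \<Sum>b\<in>ansB G. P a b x y)"
      unfolding val_def using P by (intro sum_mono) auto
    then show "val P x y \<le> 1" by (simp add: P)
  qed
  have winG: "win_prob G P = (\<Sum>x\<in>questX G. \<Sum>y\<in>questY G. pmf (qdist G) (x, y) * val P x y)" for P
    by (simp add: win_prob_eq_sum[OF game] val_def)
  \<comment> \<open>Agreement of the averages with \<open>P\<close> is demanded only at positive
    weight, since fibres may be empty elsewhere.\<close>
  have winG': "win_prob (regularized t G) P' =
      (\<Sum>x\<in>questX G. \<Sum>y\<in>questY G. rounded K G x y / K * val P x y) + loss / K"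
    if "P' \<in> C'" and "\<And>x y a b. x \<in> questX G \<Longrightarrow> y \<in> questY G \<Longrightarrow> a \<in> ansA G \<Longrightarrow> b \<in> ansB G \<Longrightarrow>
      0 < rounded K G x y \<Longrightarrow> fibre_average P' a b (Some x) (Some y) = P a b x y" for P P'
    unfolding win_prob_regularized[OF valid' that(1)] val_def
    by (intro arg_cong2[where f = "(+)"] sum.cong refl) (use that(2) in \<open>auto intro!: sum.cong\<close>)
  have ratio: "rounded K G x y / K \<le> pmf (qdist G) (x, y)" for x y
    using rounded_le[of x y] K_pos by (simp add: field_simps)
  have loss_sum: "(\<Sum>x\<in>questX G. \<Sum>y\<in>questY G. pmf (qdist G) (x, y) - rounded K G x y / K) = loss / K"
    using K_pos sum_pmf_questions[OF game]
    by (simp add: loss_eq sum_subtractf diff_divide_distrib flip: sum_divide_distrib)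
  have fib_pos: "fibX (Some x) \<noteq> {}" "fibY (Some y) \<noteq> {}"
    if "x \<in> questX G" "y \<in> questY G" "0 < rounded K G x y" for x y
    using that weight_le_row[of "Some y" "Some x"] weight_le_col[of "Some x" "Some y"]
      card_fibX[of "Some x"] card_fibY[of "Some y"] by auto
  have lower: "\<exists>P'\<in>C'. win_prob G P \<le> win_prob (regularized t G) P'" if PC: "P \<in> C" for P
  proof -
    obtain x0 y0 where 0: "x0 \<in> questX G" "y0 \<in> questY G"
      using questions_nonempty[OF game] by blast
    \<comment> \<open>Copies of the additional question play an arbitrary fixed question; they win
      with every answer.\<close>
    define f where "f u = (case labX u of Some x \<Rightarrow> x | None \<Rightarrow> x0)" for u
    define g where "g v = (case labY v of Some y \<Rightarrow> y | None \<Rightarrow> y0)" for v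
    have "f u \<in> questX G" "g u \<in> questY G" if "u < K" for u
      using that 0 labX_in[of u] labY_in[of u] by (auto simp: f_def g_def total_eq)
    then obtain P' where P': "P' \<in> C'" "\<And>u v a b. u < K \<Longrightarrow> v < K \<Longrightarrow> a \<in> ansA G \<Longrightarrow> b \<in> ansB G \<Longrightarrow>
        P' a b u v = P a b (f u) (g v)"
      using avg[unfolded averages_to_def, rule_format, OF PC, of "\<lambda>u. {f u}" "\<lambda>v. {g v}"] by auto
    have "fibre_average P' a b (Some x) (Some y) = P a b x y"
      if "x \<in> questX G" "y \<in> questY G" "a \<in> ansA G" "b \<in> ansB G" "0 < rounded K G x y" for x y a b
    proof -
      have "(\<Sum>u\<in>fibX (Some x). \<Sum>v\<in>fibY (Some y). P' a b u v) = (\<Sum>u\<in>fibX (Some x). \<Sum>v\<in>fibY (Some y). P a b x y)"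
        using that by (intro sum.cong refl) (auto simp: fibX_def fibY_def total_eq P' f_def g_def)
      then show ?thesis using fib_pos that by (simp add: fibre_average_def card_eq_0_iff)
    qed
    then have w: "win_prob (regularized t G) P' =
        (\<Sum>x\<in>questX G. \<Sum>y\<in>questY G. rounded K G x y / K * val P x y) + loss / K"
      by (rule winG'[OF P'(1)])
    have "win_prob (regularized t G) P' - win_prob G P =
        (\<Sum>x\<in>questX G. \<Sum>y\<in>questY G. rounded K G x y / K * val P x y +
          (pmf (qdist G) (x, y) - rounded K G x y / K) - pmf (qdist G) (x, y) * val P x y)"
      unfolding w winG loss_sum[symmetric] by (simp only: sum.distrib sum_subtractf)
    \<comment> \<open>At each pair the new game wins all of the lost weight, whereas the old one
      wins only the share \<open>val P x y\<close> of it.\<close>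
    also have "\<dots> = (\<Sum>x\<in>questX G. \<Sum>y\<in>questY G.
        (pmf (qdist G) (x, y) - rounded K G x y / K) * (1 - val P x y))"
      by (intro sum.cong refl) (simp only: algebra_simps)
    also have "\<dots> \<ge> 0"
      using ratio val[OF that] by (intro sum_nonneg mult_nonneg_nonneg) auto
    finally show ?thesis using P'(1) by auto
  qed
  have upper: "\<exists>P\<in>C. win_prob (regularized t G) P' \<le> win_prob G P + 1 / t" if PC: "P' \<in> C'" for P'
  proof -
    \<comment> \<open>Averaging needs nonempty sets, so a question without copies plays as copy 0,
      which exists by \<open>0 < K\<close>.\<close>
    define S where "S x = (if fibX (Some x) = {} then {0} else fibX (Some x))" for x
    define T where "T y = (if fibY (Some y) = {} then {0} else fibY (Some y))" for y
    have ST: "finite (S x)" "S x \<noteq> {}" "S x \<subseteq> {..<K}" "finite (T y)" "T y \<noteq> {}" "T y \<subseteq> {..<K}" for x y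
      using K_pos by (auto simp: S_def T_def fibX_def fibY_def total_eq)
    then obtain P where P: "P \<in> C" "\<And>x y a b. x \<in> questX G \<Longrightarrow> y \<in> questY G \<Longrightarrow> a \<in> ansA G \<Longrightarrow> b \<in> ansB G \<Longrightarrow>
        P a b x y = (\<Sum>u\<in>S x. \<Sum>v\<in>T y. P' a b u v) / (real (card (S x)) * real (card (T y)))"
      using avg'[unfolded averages_to_def, rule_format, OF PC, of S T] by auto
    have "win_prob (regularized t G) P' =
        (\<Sum>x\<in>questX G. \<Sum>y\<in>questY G. rounded K G x y / K * val P x y) + loss / K"
      by (rule winG'[OF that]) (use P fib_pos in \<open>simp add: fibre_average_def S_def T_def\<close>)
    also have "\<dots> \<le> win_prob G P + 1 / t"
      unfolding winG using ratio val[OF P(1)] loss_ratio_le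
      by (intro add_mono sum_mono mult_right_mono) auto
    finally show ?thesis using P(1) by blast
  qed
  have le1: "win_prob G P \<le> 1" if "P \<in> C" for P
  proof -
    have "win_prob G P \<le> (\<Sum>x\<in>questX G. \<Sum>y\<in>questY G. pmf (qdist G) (x, y) * 1)"
      unfolding winG using val[OF that] by (intro sum_mono mult_left_mono) auto
    then show ?thesis using sum_pmf_questions[OF game] by simp
  qed
  have bdd: "bdd_above (win_prob G ` C)"
    using le1 by (rule bdd_aboveI2)
  have bdd': "bdd_above (win_prob (regularized t G) ` C')"
  proof (rule bdd_aboveI2)
    fix P' assume "P' \<in> C'"
    then obtain P where "P \<in> C" "win_prob (regularized t G) P' \<le> win_prob G P + 1 / t"
      using upper by blast
    then show "win_prob (regularized t G) P' \<le> 1 + 1 / t" using le1[of P] by linarith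
  qed
  show "Sup (win_prob G ` C) \<le> Sup (win_prob (regularized t G) ` C')"
  \<comment> \<open>If one of the two sets of correlations is empty, so is the other, and both
    suprema are \<open>Sup {}\<close>.\<close>
  proof (cases "C = {}")
    case True
    then have "C' = {}" using upper by blast
    then show ?thesis using True by simp
  next
    case False
    then show ?thesis
      using lower bdd' by (intro cSup_mono) auto
  qed
  show "Sup (win_prob (regularized t G) ` C') \<le> Sup (win_prob G ` C) + 1 / t"
  proof (cases "C' = {}")
    case True
    then have "C = {}" using lower by blast
    then show ?thesis using True by simp
  next
    case False
    show ?thesis
    proof (rule cSup_least)
      fix z assume "z \<in> win_prob (regularized t G) ` C'"
      then obtain P where "P \<in> C" "z \<le> win_prob G P + 1 / t" using upper by auto
      moreover have "win_prob G P \<le> Sup (win_prob G ` C)"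
        using \<open>P \<in> C\<close> bdd by (intro cSup_upper) auto
      ultimately show "z \<le> Sup (win_prob G ` C) + 1 / t" by simp
    qed (use False in auto)
  qed
qed

end

section \<open>Classical correlations and their averages\<close>

definition classical_correlations ::
  "'x set \<Rightarrow> 'y set \<Rightarrow> 'a set \<Rightarrow> 'b set \<Rightarrow> ('x, 'y, 'a, 'b) correlation set" where
  "classical_correlations X Y A B = {(\<lambda>a b x y. f x a * g y b) | f g.
     classical_strategy X A f \<and> classical_strategy Y B g}"

lemma Val_eq:
  "Val G = Sup (win_prob G ` classical_correlations (questX G) (questY G) (ansA G) (ansB G))"
  unfolding Val_def classical_correlations_def by (rule arg_cong[of _ _ Sup]) blast

lemma valid_classical: "valid_correlations X Y A B (classical_correlations X Y A B)"
  by (auto simp: valid_correlations_def classical_correlations_def classical_strategy_def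
      simp flip: sum_product)

lemma classical_strategy_average:
  assumes "classical_strategy X A f" and "\<And>u. u \<in> U \<Longrightarrow> finite (S u) \<and> S u \<noteq> {} \<and> S u \<subseteq> X"
  shows "classical_strategy U A (\<lambda>u a. (\<Sum>x\<in>S u. f x a) / real (card (S u)))"
  unfolding classical_strategy_def
proof (intro ballI conjI)
  fix u a assume u: "u \<in> U"
  have card: "0 < real (card (S u))" using assms(2)[OF u] by (simp add: card_gt_0_iff)
  have f: "0 \<le> f x a" "f x a \<le> 1" "(\<Sum>a\<in>A. f x a) = 1" if "x \<in> S u" "a \<in> A" for x a
    using assms(1) assms(2)[OF u] that by (auto simp: classical_strategy_def)
  have "(\<Sum>a\<in>A. \<Sum>x\<in>S u. f x a) = (\<Sum>x\<in>S u. \<Sum>a\<in>A. f x a)" by (rule sum.swap)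
  also have "\<dots> = card (S u)"
    using assms(1) assms(2)[OF u] by (auto simp: classical_strategy_def subset_iff)
  finally show "(\<Sum>a\<in>A. (\<Sum>x\<in>S u. f x a) / real (card (S u))) = 1"
    using card by (simp flip: sum_divide_distrib)
  assume "a \<in> A"
  then show "0 \<le> (\<Sum>x\<in>S u. f x a) / real (card (S u))"
    by (intro divide_nonneg_nonneg sum_nonneg f) auto
  have "(\<Sum>x\<in>S u. f x a) \<le> real (card (S u)) * 1"
    by (rule sum_bounded_above) (use f(2) \<open>a \<in> A\<close> in auto)
  then show "(\<Sum>x\<in>S u. f x a) / real (card (S u)) \<le> 1"
    using card by simp
qed

text \<open>Each player averages over the own set of questions. The two sets are averaged
  independently, so the product of the averages is the average of the products.\<close>

lemma averages_to_classical:
  "averages_to X Y U V A B (classical_correlations X Y A B) (classical_correlations U V A B)"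
  unfolding averages_to_def
proof (intro ballI allI impI)
  fix P S T assume "P \<in> classical_correlations X Y A B"
    and ST: "(\<forall>u\<in>U. finite (S u) \<and> S u \<noteq> {} \<and> S u \<subseteq> X) \<and> (\<forall>v\<in>V. finite (T v) \<and> T v \<noteq> {} \<and> T v \<subseteq> Y)"
  then obtain f g where P: "P = (\<lambda>a b x y. f x a * g y b)"
    and fg: "classical_strategy X A f" "classical_strategy Y B g"
    by (auto simp: classical_correlations_def)
  define f' where "f' u a = (\<Sum>x\<in>S u. f x a) / real (card (S u))" for u a
  define g' where "g' v b = (\<Sum>y\<in>T v. g y b) / real (card (T v))" for v b
  have "classical_strategy U A f'" "classical_strategy V B g'"
    unfolding f'_def g'_def using ST fg by (auto intro!: classical_strategy_average)
  then have "(\<lambda>a b u v. f' u a * g' v b) \<in> classical_correlations U V A B"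
    by (auto simp: classical_correlations_def)
  moreover have "f' u a * g' v b =
      (\<Sum>x\<in>S u. \<Sum>y\<in>T v. P a b x y) / (real (card (S u)) * real (card (T v)))" for u v a b
    by (simp add: f'_def g'_def P sum_product)
  ultimately show "\<exists>P'\<in>classical_correlations U V A B. \<forall>u\<in>U. \<forall>v\<in>V. \<forall>a\<in>A. \<forall>b\<in>B.
      P' a b u v = (\<Sum>x\<in>S u. \<Sum>y\<in>T v. P a b x y) / (real (card (S u)) * real (card (T v)))"
    by (intro bexI[of _ "\<lambda>a b u v. f' u a * g' v b"]) auto
qed

section \<open>Entangled correlations and their averages\<close>

definition quantum_correlations ::
  "'x set \<Rightarrow> 'y set \<Rightarrow> 'a set \<Rightarrow> 'b set \<Rightarrow> ('x, 'y, 'a, 'b) correlation set" where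
  "quantum_correlations X Y A B = {(\<lambda>a b x y. Re ((kron (F x a) (H y b) *\<^sub>v \<psi>) \<bullet>c \<psi>)) | d \<psi> F H.
     \<psi> \<in> carrier_vec (d * d) \<and> \<psi> \<bullet>c \<psi> = 1 \<and> povm_strategy d X A F \<and> povm_strategy d Y B H}"

lemma Val_star_eq:
  "Val_star G = Sup (win_prob G ` quantum_correlations (questX G) (questY G) (ansA G) (ansB G))"
  unfolding Val_star_def quantum_correlations_def by (rule arg_cong[of _ _ Sup]) blast

lemma povm_strategyD:
  assumes "povm_strategy d X A F" "x \<in> X"
  shows "a \<in> A \<Longrightarrow> psd d (F x a)" "a \<in> A \<Longrightarrow> F x a \<in> carrier_mat d d"
    and "i < d \<Longrightarrow> j < d \<Longrightarrow> (\<Sum>a\<in>A. F x a $$ (i, j)) = of_bool (i = j)"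
proof -
  have "mat d d (\<lambda>ij. \<Sum>a\<in>A. F x a $$ ij) = 1\<^sub>m d"
    using assms by (simp add: povm_strategy_def)
  then have "mat d d (\<lambda>ij. \<Sum>a\<in>A. F x a $$ ij) $$ (i, j) = 1\<^sub>m d $$ (i, j)" by simp
  then show "i < d \<Longrightarrow> j < d \<Longrightarrow> (\<Sum>a\<in>A. F x a $$ (i, j)) = of_bool (i = j)" by simp
qed (use assms in \<open>auto simp: povm_strategy_def psd_def\<close>)

text \<open>The matrices of all answers sum to the identity on both sides, so by bilinearity the
  total is the squared norm of \<psi>.\<close>

lemma valid_quantum: "valid_correlations X Y A B (quantum_correlations X Y A B)"
  unfolding valid_correlations_def
proof (intro ballI)
  fix P x y assume "P \<in> quantum_correlations X Y A B" and x: "x \<in> X" and y: "y \<in> Y"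
  then obtain d \<psi> F H where P: "P = (\<lambda>a b x y. Re ((kron (F x a) (H y b) *\<^sub>v \<psi>) \<bullet>c \<psi>))"
    and \<psi>: "\<psi> \<in> carrier_vec (d * d)" "\<psi> \<bullet>c \<psi> = 1"
    and F: "povm_strategy d X A F" and H: "povm_strategy d Y B H"
    by (auto simp: quantum_correlations_def)
  have form: "P a b x y = Re (tensor_form d \<psi> (($$) (F x a)) (($$) (H y b)))" if "a \<in> A" "b \<in> B" for a b
    using povm_strategyD(2)[OF F x] povm_strategyD(2)[OF H y] that \<psi> by (simp add: P kron_tensor_form[of _ d])
  have "(\<Sum>a\<in>A. \<Sum>b\<in>B. P a b x y) = (\<Sum>a\<in>A. \<Sum>b\<in>B. Re (tensor_form d \<psi> (($$) (F x a)) (($$) (H y b))))"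
    by (simp add: form)
  also have "\<dots> = Re (tensor_form d \<psi> (\<lambda>p. \<Sum>a\<in>A. F x a $$ p) (\<lambda>p. \<Sum>b\<in>B. H y b $$ p))"
    unfolding tensor_form_sum by simp
  also have "tensor_form d \<psi> (\<lambda>p. \<Sum>a\<in>A. F x a $$ p) (\<lambda>p. \<Sum>b\<in>B. H y b $$ p) =
      tensor_form d \<psi> (\<lambda>(i, j). of_bool (i = j)) (\<lambda>(i, j). of_bool (i = j))"
    by (rule tensor_form_cong) (simp_all add: povm_strategyD(3)[OF F x] povm_strategyD(3)[OF H y])
  finally have "(\<Sum>a\<in>A. \<Sum>b\<in>B. P a b x y) = 1"
    using \<psi> by (simp add: tensor_form_id)
  moreover have "0 \<le> P a b x y" if "a \<in> A" "b \<in> B" for a b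
    using that by (simp add: form tensor_form_nonneg povm_strategyD(1)[OF F x] povm_strategyD(1)[OF H y])
  ultimately show "(\<forall>a\<in>A. \<forall>b\<in>B. 0 \<le> P a b x y) \<and> (\<Sum>a\<in>A. \<Sum>b\<in>B. P a b x y) = 1" by blast
qed

lemma povm_strategy_average:
  assumes F: "povm_strategy d X A F" and S: "\<And>u. u \<in> U \<Longrightarrow> finite (S u) \<and> S u \<noteq> {} \<and> S u \<subseteq> X"
  shows "povm_strategy d U A (\<lambda>u a. mat d d (\<lambda>ij. (\<Sum>x\<in>S u. F x a $$ ij) / of_nat (card (S u))))"
  unfolding povm_strategy_def
proof (intro ballI conjI)
  fix u a assume u: "u \<in> U"
  have x: "x \<in> X" if "x \<in> S u" for x using S[OF u] that by blast
  show "a \<in> A \<Longrightarrow> psd d (mat d d (\<lambda>ij. (\<Sum>x\<in>S u. F x a $$ ij) / of_nat (card (S u))))"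
    by (intro psd_average povm_strategyD(1)[OF F x])
  have "(\<Sum>a\<in>A. (\<Sum>x\<in>S u. F x a $$ (i, j)) / of_nat (card (S u))) = of_bool (i = j)"
    if "i < d" "j < d" for i j
  proof -
    have "(\<Sum>a\<in>A. \<Sum>x\<in>S u. F x a $$ (i, j)) = (\<Sum>x\<in>S u. \<Sum>a\<in>A. F x a $$ (i, j))" by (rule sum.swap)
    also have "\<dots> = of_nat (card (S u)) * of_bool (i = j)"
      using povm_strategyD(3)[OF F x that] by simp
    finally show ?thesis using S[OF u] by (simp add: card_eq_0_iff flip: sum_divide_distrib)
  qed
  then show "mat d d (\<lambda>ij. \<Sum>a\<in>A. mat d d (\<lambda>ij. (\<Sum>x\<in>S u. F x a $$ ij) / of_nat (card (S u))) $$ ij) = 1\<^sub>m d"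
    by (intro eq_matI) auto
qed

text \<open>State and dimension are kept and the measurement matrices are averaged; the bracket is
  bilinear in them.\<close>

lemma averages_to_quantum:
  "averages_to X Y U V A B (quantum_correlations X Y A B) (quantum_correlations U V A B)"
  unfolding averages_to_def
proof (intro ballI allI impI)
  fix P S T assume "P \<in> quantum_correlations X Y A B"
    and ST: "(\<forall>u\<in>U. finite (S u) \<and> S u \<noteq> {} \<and> S u \<subseteq> X) \<and> (\<forall>v\<in>V. finite (T v) \<and> T v \<noteq> {} \<and> T v \<subseteq> Y)"
  then obtain d \<psi> F H where P: "P = (\<lambda>a b x y. Re ((kron (F x a) (H y b) *\<^sub>v \<psi>) \<bullet>c \<psi>))"
    and \<psi>: "\<psi> \<in> carrier_vec (d * d)" "\<psi> \<bullet>c \<psi> = 1"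
    and F: "povm_strategy d X A F" and H: "povm_strategy d Y B H"
    by (auto simp: quantum_correlations_def)
  define F' where "F' u a = mat d d (\<lambda>ij. (\<Sum>x\<in>S u. F x a $$ ij) / of_nat (card (S u)))" for u a
  define H' where "H' v b = mat d d (\<lambda>ij. (\<Sum>y\<in>T v. H y b $$ ij) / of_nat (card (T v)))" for v b
  define P' where "P' a b u v = Re ((kron (F' u a) (H' v b) *\<^sub>v \<psi>) \<bullet>c \<psi>)" for a b u v
  have "povm_strategy d U A F'" "povm_strategy d V B H'"
    unfolding F'_def H'_def using ST by (auto intro!: povm_strategy_average[OF F] povm_strategy_average[OF H])
  then have "P' \<in> quantum_correlations U V A B"
    using \<psi> unfolding quantum_correlations_def P'_def by blast
  moreover have "P' a b u v =
      (\<Sum>x\<in>S u. \<Sum>y\<in>T v. P a b x y) / (real (card (S u)) * real (card (T v)))"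
    if "u \<in> U" "v \<in> V" "a \<in> A" "b \<in> B" for u v a b
  proof -
    have "P' a b u v = Re (tensor_form d \<psi> (($$) (F' u a)) (($$) (H' v b)))"
      unfolding P'_def by (subst kron_tensor_form) (simp_all add: F'_def H'_def \<psi>)
    also have "tensor_form d \<psi> (($$) (F' u a)) (($$) (H' v b)) =
        tensor_form d \<psi> (\<lambda>p. (\<Sum>x\<in>S u. F x a $$ p) / of_nat (card (S u)))
          (\<lambda>p. (\<Sum>y\<in>T v. H y b $$ p) / of_nat (card (T v)))"
      by (rule tensor_form_cong) (simp_all add: F'_def H'_def)
    also have "\<dots> = (\<Sum>x\<in>S u. \<Sum>y\<in>T v. tensor_form d \<psi> (($$) (F x a)) (($$) (H y b))) /
        (of_nat (card (S u)) * of_nat (card (T v)))"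
      unfolding tensor_form_sum tensor_form_divide
      by (simp add: mult.commute flip: sum_divide_distrib)
    also have "\<dots> = (\<Sum>x\<in>S u. \<Sum>y\<in>T v. (kron (F x a) (H y b) *\<^sub>v \<psi>) \<bullet>c \<psi>) /
        of_nat (card (S u) * card (T v))"
    proof -
      have "tensor_form d \<psi> (($$) (F x a)) (($$) (H y b)) = (kron (F x a) (H y b) *\<^sub>v \<psi>) \<bullet>c \<psi>"
        if "x \<in> S u" "y \<in> T v" for x y
        using that ST \<open>u \<in> U\<close> \<open>v \<in> V\<close> \<open>a \<in> A\<close> \<open>b \<in> B\<close> \<psi> povm_strategyD(2)[OF F] povm_strategyD(2)[OF H]
        by (subst kron_tensor_form) (auto simp: subset_iff)
      then show ?thesis by simp
    qed
    finally show ?thesis by (simp only: Re_divide_of_nat P Re_sum) simp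
  qed
  ultimately show "\<exists>P'\<in>quantum_correlations U V A B. \<forall>u\<in>U. \<forall>v\<in>V. \<forall>a\<in>A. \<forall>b\<in>B.
      P' a b u v = (\<Sum>x\<in>S u. \<Sum>y\<in>T v. P a b x y) / (real (card (S u)) * real (card (T v)))"
    by blast
qed

context rounded_game
begin

lemma Val_close:
  "Val G \<le> Val (regularized t G)" "Val (regularized t G) \<le> Val G + 1 / t"
  using values_close[OF valid_classical valid_classical averages_to_classical averages_to_classical]
  unfolding Val_eq regularized_sel by auto

lemma Val_star_close:
  "Val_star G \<le> Val_star (regularized t G)" "Val_star (regularized t G) \<le> Val_star G + 1 / t"
  using values_close[OF valid_quantum valid_quantum averages_to_quantum averages_to_quantum]
  unfolding Val_star_eq regularized_sel by auto

end

section \<open>Total correctness and running time of programs\<close>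

lemma less_bits: "n < 2 ^ bits n"
proof -
  have "n < 2 ^ floorlog 2 n"
    using floorlog_bounds[of n 2] by (cases "n = 0") auto
  also have "\<dots> \<le> 2 ^ bits n"
    by (intro power_increasing) (auto simp: bits_def)
  finally show ?thesis .
qed

lemma bits_le: "n < 2 ^ B \<Longrightarrow> 0 < B \<Longrightarrow> bits n \<le> B"
  by (auto simp: bits_def intro!: floorlog_leI)

lemma member_le_code_size: "x \<in> set ws \<Longrightarrow> x < 2 ^ code_size ws"
proof -
  assume "x \<in> set ws"
  have "x < 2 ^ bits x" by (rule less_bits)
  also have "\<dots> \<le> 2 ^ code_size ws"
    unfolding code_size_def using \<open>x \<in> set ws\<close> by (intro power_increasing member_le_sum_list) auto
  finally show ?thesis .
qed

lemma length_le_code_size: "length ws \<le> code_size ws"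
proof -
  have "(\<Sum>w\<leftarrow>ws. 1) \<le> code_size ws"
    unfolding code_size_def by (intro sum_list_mono) (simp add: bits_def)
  then show ?thesis by (simp add: sum_list_triv)
qed

text \<open>Addresses count as well as literals, since the machine charges both by their bit
  length.\<close>

fun consts_addr :: "addr \<Rightarrow> nat set" where
  "consts_addr (Dir i) = {i}"
| "consts_addr (Ind i) = {i}"

fun consts_operand :: "operand \<Rightarrow> nat set" where
  "consts_operand (Const n) = {n}"
| "consts_operand (At r) = consts_addr r"

fun consts_com :: "com \<Rightarrow> nat set" where
  "consts_com Skip = {}"
| "consts_com (Assign r f u v) = consts_addr r \<union> consts_operand u \<union> consts_operand v"
| "consts_com (Read r) = consts_addr r"
| "consts_com (Write u) = consts_operand u"
| "consts_com (Seq c d) = consts_com c \<union> consts_com d"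
| "consts_com (Cond u c d) = consts_operand u \<union> consts_com c \<union> consts_com d"
| "consts_com (While u c) = consts_operand u \<union> consts_com c"

text \<open>A bound for the number of instructions and tests if every loop makes at most
  \<open>D\<close> passes; a loop of \<open>D\<close> passes is tested \<open>D + 1\<close>
  times.\<close>

fun steps :: "nat \<Rightarrow> com \<Rightarrow> nat" where
  "steps D (Seq c d) = steps D c + steps D d"
| "steps D (Cond u c d) = 1 + steps D c + steps D d"
| "steps D (While u c) = (D + 1) * (steps D c + 1)"
| "steps D _ = 1"

lemma steps_poly: "\<exists>p :: nat poly. \<forall>D. steps D c = poly p D"
proof (induction c)
  case (Seq c d)
  then obtain p q where "\<forall>D. steps D c = poly p D" "\<forall>D. steps D d = poly q D" by blast
  then have "\<forall>D. steps D (Seq c d) = poly (p + q) D" by simp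
  then show ?case by blast
next
  case (Cond u c d)
  then obtain p q where "\<forall>D. steps D c = poly p D" "\<forall>D. steps D d = poly q D" by blast
  then have "\<forall>D. steps D (Cond u c d) = poly (1 + p + q) D" by simp
  then show ?case by blast
next
  case (While u c)
  then obtain p where "\<forall>D. steps D c = poly p D" by blast
  then have "\<forall>D. steps D (While u c) = poly ([:1, 1:] * (p + 1)) D" by simp
  then show ?case by blast
qed (auto intro!: exI[of _ 1])

text \<open>The output is left out: it is never read back, and writing is charged by the
  operand.\<close>

definition small :: "nat \<Rightarrow> config \<Rightarrow> bool" where
  "small B = (\<lambda>(s, inp, out). (\<forall>i. s i < 2 ^ B) \<and> (\<forall>w\<in>set inp. w < 2 ^ B))"

text \<open>
  The weakest precondition of total correctness under a bit bound \<open>B\<close> for all numbers and an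
  iteration bound \<open>D\<close> for all loops. With these two bounds the running time depends on the
  syntax of the command only, so that proofs about programs need no accounting of costs.
\<close>

definition wp :: "nat \<Rightarrow> nat \<Rightarrow> com \<Rightarrow> (config \<Rightarrow> bool) \<Rightarrow> config \<Rightarrow> bool" where
  "wp B D c Q \<sigma> \<longleftrightarrow> 0 < B \<longrightarrow> (\<forall>k\<in>consts_com c. k < 2 ^ B) \<longrightarrow> small B \<sigma> \<longrightarrow>
     (\<exists>t \<sigma>'. exec c \<sigma> t \<sigma>' \<and> t \<le> steps D c * (10 * B) \<and> small B \<sigma>' \<and> Q \<sigma>')"

lemma addr_cost_le:
  assumes "0 < B" "\<forall>k\<in>consts_addr r. k < 2 ^ B" "\<forall>i. s i < 2 ^ B"
  shows "addr_cost s r \<le> 2 * B"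
proof (cases r)
  case (Dir i)
  then show ?thesis using assms bits_le[of i B] by auto
next
  case (Ind i)
  then show ?thesis using assms bits_le[of i B] bits_le[of "s i" B] by auto
qed

lemma operand_cost_le:
  assumes "0 < B" "\<forall>k\<in>consts_operand u. k < 2 ^ B" "\<forall>i. s i < 2 ^ B"
  shows "operand_cost s u \<le> 3 * B"
proof (cases u)
  case (Const n)
  then show ?thesis using assms bits_le[of n B] by auto
next
  case (At r)
  then show ?thesis
    using assms addr_cost_le[of B r s] bits_le[of "s (loc s r)" B] by auto
qed

lemma operand_val_less:
  assumes "\<forall>k\<in>consts_operand u. k < 2 ^ B" "\<forall>i. s i < 2 ^ B"
  shows "operand_val s u < 2 ^ B"
  using assms by (cases u) auto

text \<open>Only sums and products can leave the bit range; truncated differences and quotients are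
  at most their first operand.\<close>

lemma wp_Assign:
  assumes "Q (s(loc s r := apply_op f (operand_val s u) (operand_val s v)), inp, out)"
    and "(\<forall>i. s i < 2 ^ B) \<Longrightarrow> f = Add \<or> f = Mult \<Longrightarrow>
      apply_op f (operand_val s u) (operand_val s v) < 2 ^ B"
  shows "wp B D (Assign r f u v) Q (s, inp, out)"
  unfolding wp_def
proof (intro impI)
  let ?w = "apply_op f (operand_val s u) (operand_val s v)"
  assume *: "0 < B" "\<forall>k\<in>consts_com (Assign r f u v). k < 2 ^ B" "small B (s, inp, out)"
  then have s: "\<forall>i. s i < 2 ^ B" by (simp add: small_def)
  have "operand_val s u < 2 ^ B" using * s by (intro operand_val_less) auto
  then have w: "?w < 2 ^ B"
    using assms(2) s
    by (cases f) (auto intro: le_less_trans[OF diff_le_self] le_less_trans[OF div_le_dividend])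
  \<comment> \<open>An assignment costs at most \<open>1 + 3 * B + 3 * B + 2 * B + B\<close>, which
    is the source of the factor 10.\<close>
  have "addr_cost s r \<le> 2 * B" "operand_cost s u \<le> 3 * B" "operand_cost s v \<le> 3 * B"
    "bits ?w \<le> B"
    using * s w by (auto intro!: addr_cost_le operand_cost_le bits_le)
  show "\<exists>t \<sigma>'. exec (Assign r f u v) (s, inp, out) t \<sigma>' \<and> t \<le> steps D (Assign r f u v) * (10 * B) \<and>
      small B \<sigma>' \<and> Q \<sigma>'"
    using s w * \<open>addr_cost s r \<le> 2 * B\<close> \<open>operand_cost s u \<le> 3 * B\<close> \<open>operand_cost s v \<le> 3 * B\<close>
      \<open>bits ?w \<le> B\<close>
    by - (rule exI, rule exI, rule conjI, rule exec.Assign[OF refl], use assms(1) in \<open>auto simp: small_def\<close>)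
qed

lemma wp_Read:
  assumes "Q (s(loc s r := w), inp, out)"
  shows "wp B D (Read r) Q (s, w # inp, out)"
  unfolding wp_def
proof (intro impI)
  assume *: "0 < B" "\<forall>k\<in>consts_com (Read r). k < 2 ^ B" "small B (s, w # inp, out)"
  then have "addr_cost s r \<le> 2 * B" "bits w \<le> B"
    by (auto simp: small_def intro!: addr_cost_le bits_le)
  then show "\<exists>t \<sigma>'. exec (Read r) (s, w # inp, out) t \<sigma>' \<and>
      t \<le> steps D (Read r) * (10 * B) \<and> small B \<sigma>' \<and> Q \<sigma>'"
    using * by - (rule exI, rule exI, rule conjI, rule exec.Read, use assms in \<open>auto simp: small_def\<close>)
qed

lemma wp_Write:
  assumes "Q (s, inp, out @ [operand_val s u])"
  shows "wp B D (Write u) Q (s, inp, out)"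
  unfolding wp_def
proof (intro impI)
  assume *: "0 < B" "\<forall>k\<in>consts_com (Write u). k < 2 ^ B" "small B (s, inp, out)"
  then have "operand_cost s u \<le> 3 * B"
    by (intro operand_cost_le) (auto simp: small_def)
  then show "\<exists>t \<sigma>'. exec (Write u) (s, inp, out) t \<sigma>' \<and>
      t \<le> steps D (Write u) * (10 * B) \<and> small B \<sigma>' \<and> Q \<sigma>'"
    using * by - (rule exI, rule exI, rule conjI, rule exec.Write, use assms in \<open>auto simp: small_def\<close>)
qed

lemma wp_Seq:
  assumes "wp B D c (wp B D d Q) \<sigma>"
  shows "wp B D (Seq c d) Q \<sigma>"
  unfolding wp_def
proof (intro impI)
  assume *: "0 < B" "\<forall>k\<in>consts_com (Seq c d). k < 2 ^ B" "small B \<sigma>"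
  then obtain t \<sigma>' where 1: "exec c \<sigma> t \<sigma>'" "t \<le> steps D c * (10 * B)" "small B \<sigma>'" "wp B D d Q \<sigma>'"
    using assms unfolding wp_def by fastforce
  then obtain t' \<sigma>'' where 2: "exec d \<sigma>' t' \<sigma>''" "t' \<le> steps D d * (10 * B)" "small B \<sigma>''" "Q \<sigma>''"
    using * unfolding wp_def by fastforce
  have "t + t' \<le> steps D (Seq c d) * (10 * B)"
    using 1 2 by (simp add: algebra_simps)
  then show "\<exists>t \<sigma>'. exec (Seq c d) \<sigma> t \<sigma>' \<and> t \<le> steps D (Seq c d) * (10 * B) \<and>
      small B \<sigma>' \<and> Q \<sigma>'"
    using 1 2 exec.Seq by blast
qed

lemma wp_mono:
  assumes "wp B D c Q \<sigma>" "\<And>\<sigma>'. small B \<sigma>' \<Longrightarrow> Q \<sigma>' \<Longrightarrow> R \<sigma>'"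
  shows "wp B D c R \<sigma>"
  using assms unfolding wp_def by blast

lemma wp_assume_small: "(small B \<sigma> \<Longrightarrow> wp B D c Q \<sigma>) \<Longrightarrow> wp B D c Q \<sigma>"
  unfolding wp_def by blast

text \<open>The index of the invariant is the exact number of passes still to come. So it decides
  the test, and it gives the cost of \<open>k + 1\<close> tests and \<open>k\<close> passes.\<close>

lemma wp_While_aux:
  assumes step: "\<And>k s inp out. I (Suc k) (s, inp, out) \<Longrightarrow> operand_val s u \<noteq> 0 \<and> wp B D c (I k) (s, inp, out)"
    and stop: "\<And>s inp out. I 0 (s, inp, out) \<Longrightarrow> operand_val s u = 0"
    and pre: "0 < B" "\<forall>k\<in>consts_com (While u c). k < 2 ^ B"
  shows "small B \<sigma> \<Longrightarrow> I k \<sigma> \<Longrightarrow>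
    \<exists>t \<sigma>'. exec (While u c) \<sigma> t \<sigma>' \<and> t \<le> (k + 1) * ((steps D c + 1) * (10 * B)) \<and>
      small B \<sigma>' \<and> I 0 \<sigma>'"
proof (induction k arbitrary: \<sigma>)
  case 0
  obtain s inp out where \<sigma>: "\<sigma> = (s, inp, out)" by (metis prod_cases3)
  have "operand_cost s u \<le> 3 * B"
    using pre 0 \<sigma> by (intro operand_cost_le) (auto simp: small_def)
  then have "1 + operand_cost s u \<le> (0 + 1) * ((steps D c + 1) * (10 * B))"
    using pre by (simp add: algebra_simps)
  then show ?case using 0 \<sigma> stop exec.While_zero by blast
next
  case (Suc k)
  obtain s inp out where \<sigma>: "\<sigma> = (s, inp, out)" by (metis prod_cases3)
  have cost: "operand_cost s u \<le> 3 * B"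
    using pre Suc \<sigma> by (intro operand_cost_le) (auto simp: small_def)
  obtain t \<sigma>' where 1: "exec c \<sigma> t \<sigma>'" "t \<le> steps D c * (10 * B)" "small B \<sigma>'" "I k \<sigma>'"
    using step[of k s inp out] Suc.prems pre \<sigma> unfolding wp_def by fastforce
  obtain t' \<sigma>'' where 2: "exec (While u c) \<sigma>' t' \<sigma>''"
    "t' \<le> (k + 1) * ((steps D c + 1) * (10 * B))" "small B \<sigma>''" "I 0 \<sigma>''"
    using Suc.IH[OF 1(3,4)] by blast
  have "operand_val s u \<noteq> 0" using step Suc.prems \<sigma> by blast
  then have "exec (While u c) \<sigma> (1 + operand_cost s u + t + t') \<sigma>''"
    using exec.While_nonzero[of s u c inp out t \<sigma>' t' \<sigma>''] 1 2 by (simp add: \<sigma>)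
  moreover have "1 + operand_cost s u + t + t' \<le> (Suc k + 1) * ((steps D c + 1) * (10 * B))"
    using 1 2 cost pre by (simp add: algebra_simps)
  ultimately show ?case using 2 by blast
qed

lemma wp_While:
  assumes step: "\<And>k s inp out. I (Suc k) (s, inp, out) \<Longrightarrow> operand_val s u \<noteq> 0 \<and> wp B D c (I k) (s, inp, out)"
    and stop: "\<And>s inp out. I 0 (s, inp, out) \<Longrightarrow> operand_val s u = 0"
    and "I k \<sigma>" "k \<le> D"
    and Q: "\<And>\<sigma>'. small B \<sigma>' \<Longrightarrow> I 0 \<sigma>' \<Longrightarrow> Q \<sigma>'"
  shows "wp B D (While u c) Q \<sigma>"
  unfolding wp_def
proof (intro impI)
  assume *: "0 < B" "\<forall>k\<in>consts_com (While u c). k < 2 ^ B" "small B \<sigma>"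
  have "\<exists>t \<sigma>'. exec (While u c) \<sigma> t \<sigma>' \<and> t \<le> (k + 1) * ((steps D c + 1) * (10 * B)) \<and>
      small B \<sigma>' \<and> I 0 \<sigma>'"
    by (rule wp_While_aux[where I = I]) (use step stop * assms(3) in \<open>blast+\<close>)
  then obtain t \<sigma>' where "exec (While u c) \<sigma> t \<sigma>'" "t \<le> (k + 1) * ((steps D c + 1) * (10 * B))"
      "small B \<sigma>'" "I 0 \<sigma>'"
    by blast
  moreover have "(k + 1) * ((steps D c + 1) * (10 * B)) \<le> steps D (While u c) * (10 * B)"
    using \<open>k \<le> D\<close> by (simp only: steps.simps mult.assoc) (intro mult_right_mono, auto)
  ultimately show "\<exists>t \<sigma>'. exec (While u c) \<sigma> t \<sigma>' \<and> t \<le> steps D (While u c) * (10 * B) \<and>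
      small B \<sigma>' \<and> Q \<sigma>'"
    using Q by (meson order_trans)
qed

text \<open>\<open>i\<close> counts up for the use of the body, and \<open>r\<close> counts down to
  serve as the test. The bound \<open>u\<close> is evaluated once, after \<open>i\<close> has been
  cleared; this is why \<open>wp_For\<close> evaluates it in \<open>s(i := 0)\<close>.\<close>

definition For :: "nat \<Rightarrow> nat \<Rightarrow> operand \<Rightarrow> com \<Rightarrow> com" where
  "For i r u c = Seq (Assign (Dir i) Add (Const 0) (Const 0)) (Seq (Assign (Dir r) Add u (Const 0))
     (While (At (Dir r)) (Seq c (Seq (Assign (Dir i) Add (At (Dir i)) (Const 1))
        (Assign (Dir r) Sub (At (Dir r)) (Const 1))))))"

text \<open>\<open>frame\<close> makes the invariant blind to both counters, which the loop
  overwrites. The body is given their values as hypotheses and has to leave them intact.\<close>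

lemma wp_For:
  assumes ir: "i \<noteq> r"
    and n: "operand_val (s(i := 0)) u = n" "n \<le> D" "n < 2 ^ B"
    and frame: "\<And>k s inp out a b. I k (s, inp, out) \<Longrightarrow> I k (s(i := a, r := b), inp, out)"
    and init: "I 0 (s, inp, out)"
    and step: "\<And>k s inp out. k < n \<Longrightarrow> I k (s, inp, out) \<Longrightarrow> s i = k \<Longrightarrow> s r = n - k \<Longrightarrow> (\<forall>j. s j < 2 ^ B) \<Longrightarrow>
      wp B D c (\<lambda>(s', inp', out'). s' i = k \<and> s' r = n - k \<and> I (Suc k) (s', inp', out')) (s, inp, out)"
    and Q: "\<And>s inp out. I n (s, inp, out) \<Longrightarrow> (\<forall>j. s j < 2 ^ B) \<Longrightarrow> Q (s, inp, out)"
  shows "wp B D (For i r u c) Q (s, inp, out)"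
proof -
  \<comment> \<open>\<open>wp_While\<close> counts the remaining passes, \<open>I\<close> the
    completed ones.\<close>
  define J where "J k = (\<lambda>(s, inp, out). k \<le> n \<and> s i = n - k \<and> s r = k \<and>
    I (n - k) (s, inp, out))" for k
  have I: "I 0 (s(i := 0, r := n), inp, out)" using frame[OF init] .
  have "wp B D (While (At (Dir r)) (Seq c (Seq (Assign (Dir i) Add (At (Dir i)) (Const 1))
        (Assign (Dir r) Sub (At (Dir r)) (Const 1))))) Q (s(i := 0, r := n), inp, out)"
  proof (rule wp_While[where I = J and k = n])
    fix k s inp out assume J: "J (Suc k) (s, inp, out)"
    have *: "n - (n - Suc k) = Suc k" "Suc (n - Suc k) = n - k" "k < n"
      using J by (auto simp: J_def)
    have "wp B D c (wp B D (Seq (Assign (Dir i) Add (At (Dir i)) (Const 1))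
        (Assign (Dir r) Sub (At (Dir r)) (Const 1))) (J k)) (s, inp, out)"
      if "small B (s, inp, out)"
    proof (rule wp_mono[OF step[of "n - Suc k"]])
      fix \<sigma>' assume "small B \<sigma>'"
        and "case \<sigma>' of (s', inp', out') \<Rightarrow> s' i = n - Suc k \<and> s' r = n - (n - Suc k) \<and>
          I (Suc (n - Suc k)) (s', inp', out')"
      then obtain s' inp' out' where \<sigma>': "\<sigma>' = (s', inp', out')" and s': "s' i = n - Suc k" "s' r = Suc k"
        "I (n - k) (s', inp', out')" "\<forall>j. s' j < 2 ^ B"
        using * by (auto simp: small_def)
      have "J k (s'(i := n - k, r := k), inp', out')"
        using frame[OF s'(3)] ir * by (auto simp: J_def)
      then show "wp B D (Seq (Assign (Dir i) Add (At (Dir i)) (Const 1))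
        (Assign (Dir r) Sub (At (Dir r)) (Const 1))) (J k) \<sigma>'"
        unfolding \<sigma>' using s' ir * n
        by (intro wp_Seq wp_Assign) auto
    qed (use J that * in \<open>auto simp: J_def small_def\<close>)
    then show "operand_val s (At (Dir r)) \<noteq> 0 \<and> wp B D (Seq c (Seq (Assign (Dir i) Add (At (Dir i)) (Const 1))
        (Assign (Dir r) Sub (At (Dir r)) (Const 1)))) (J k) (s, inp, out)"
      using J by (auto simp: J_def intro: wp_assume_small wp_Seq)
  qed (use I ir n Q in \<open>auto simp: J_def small_def\<close>)
  then show ?thesis
    unfolding For_def using n by (intro wp_Seq wp_Assign) auto
qed

section \<open>A program for the regularized game\<close>

abbreviation reg :: "nat \<Rightarrow> operand" where "reg k \<equiv> At (Dir k)"
abbreviation ind :: "nat \<Rightarrow> operand" where "ind k \<equiv> At (Ind k)"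

text \<open>
  The weight of a pair \<open>(i, j)\<close> is stored at an even address and the complemented bits of the winning predicate
  at odd addresses, both from 40 on. Unwritten cells are 0, which is the right value for
  the additional question on either side: no weight with the other questions, and always winning.
  The product of the answer numbers (register 4) is used as a single loop bound, since one of
  them may be huge if the other one is 0.
\<close>

lemma double_bounds:
  fixes x P R b :: nat
  assumes "2 * P + 2 * R + 50 \<le> b" "x < P \<or> x < R"
  shows "x * 2 + 41 < b" "x * 2 + 40 < b" "x * 2 < b" "x < b"
  using assms by linarith+

definition weight_addr :: "nat \<Rightarrow> nat \<Rightarrow> com" where
  "weight_addr a b = Seq (Assign (Dir 22) Mult (reg a) (reg 6)) (Seq (Assign (Dir 22) Add (reg 22) (reg b))
     (Seq (Assign (Dir 22) Mult (reg 22) (Const 2)) (Assign (Dir 22) Add (reg 22) (Const 40))))"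

definition bit_addr :: "nat \<Rightarrow> nat \<Rightarrow> nat \<Rightarrow> com" where
  "bit_addr a b c = Seq (Assign (Dir 22) Mult (reg a) (reg 6)) (Seq (Assign (Dir 22) Add (reg 22) (reg b))
     (Seq (Assign (Dir 22) Mult (reg 22) (reg 4)) (Seq (Assign (Dir 22) Add (reg 22) (reg c))
     (Seq (Assign (Dir 22) Mult (reg 22) (Const 2)) (Assign (Dir 22) Add (reg 22) (Const 41))))))"

text \<open>Register map: 0 and 1 hold |X| and |Y|, 2 and 3 the answer numbers, 4 their product, 5
  the scale \<open>K\<close>, 6 and 7 the padded sizes |Y| + 1 and |X| + 1, and 8 the weight not yet
  distributed.\<close>

definition read_header :: "nat \<Rightarrow> com" where
  "read_header t = Seq (Read (Dir 0)) (Seq (Read (Dir 1)) (Seq (Read (Dir 2)) (Seq (Read (Dir 3))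
     (Seq (Assign (Dir 4) Mult (reg 2) (reg 3)) (Seq (Assign (Dir 5) Mult (Const t) (reg 0))
     (Seq (Assign (Dir 5) Mult (reg 5) (reg 1)) (Seq (Assign (Dir 6) Add (reg 1) (Const 1))
     (Seq (Assign (Dir 7) Add (reg 0) (Const 1)) (Assign (Dir 8) Add (reg 5) (Const 0))))))))))"

text \<open>Register 8 is reduced by each rounded weight. The rest goes to the last position of the
  padded table, whose indices |X| and |Y|, counted from 0, are the contents of registers 0 and
  1.\<close>

definition read_weights :: com where
  "read_weights = Seq
     (For 10 11 (reg 0) (For 12 13 (reg 1)
       (Seq (Read (Dir 20)) (Seq (Read (Dir 21)) (Seq (Assign (Dir 20) Mult (reg 5) (reg 20))
       (Seq (Assign (Dir 20) Div (reg 20) (reg 21)) (Seq (Assign (Dir 8) Sub (reg 8) (reg 20))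
       (Seq (weight_addr 10 12) (Assign (Ind 22) Add (reg 20) (Const 0))))))))))
     (Seq (weight_addr 0 1) (Assign (Ind 22) Add (reg 8) (Const 0)))"

definition read_bits :: com where
  "read_bits = For 10 11 (reg 0) (For 12 13 (reg 1) (For 18 19 (reg 4)
     (Seq (Read (Dir 20)) (Seq (Assign (Dir 20) Sub (Const 1) (reg 20))
     (Seq (bit_addr 10 12 18) (Assign (Ind 22) Add (reg 20) (Const 0)))))))"

text \<open>Registers 23 and 24 hold the row sum and the column sum, which are the numbers of
  copies; registers 14 to 17 count these copies. The column sum is recomputed for every copy of a
  row: this costs a polynomial factor and saves an array.\<close>

definition table :: "com \<Rightarrow> com" where
  "table c = For 10 11 (reg 7) (Seq (Assign (Dir 23) Add (Const 0) (Const 0))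
     (Seq (For 12 13 (reg 6) (Seq (weight_addr 10 12) (Assign (Dir 23) Add (reg 23) (ind 22))))
     (For 14 15 (reg 23) (For 12 13 (reg 6) (Seq (Assign (Dir 24) Add (Const 0) (Const 0))
       (Seq (For 18 19 (reg 7) (Seq (weight_addr 18 12) (Assign (Dir 24) Add (reg 24) (ind 22))))
       (For 16 17 (reg 24) c)))))))"

text \<open>The fraction is not reduced. Its denominator is positive wherever it is written, since a
  pair is written \<open>row * col\<close> times.\<close>

definition write_weight :: com where
  "write_weight = Seq (weight_addr 10 12) (Seq (Assign (Dir 26) Mult (reg 23) (reg 24))
     (Seq (Assign (Dir 26) Mult (reg 26) (reg 5)) (Seq (Write (ind 22)) (Write (reg 26)))))"

definition write_bits :: com where
  "write_bits = For 18 19 (reg 4) (Seq (bit_addr 10 12 18)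
     (Seq (Assign (Dir 20) Sub (Const 1) (ind 22)) (Write (reg 20))))"

definition regularize :: "nat \<Rightarrow> com" where
  "regularize t = Seq (read_header t) (Seq read_weights (Seq read_bits
     (Seq (Write (reg 5)) (Seq (Write (reg 5)) (Seq (Write (reg 2)) (Seq (Write (reg 3))
     (Seq (table write_weight) (table write_bits))))))))"

lemma consts_regularize: "consts_com (regularize t) \<subseteq> {..41} \<union> {t}"
  by (simp add: regularize_def table_def write_weight_def write_bits_def read_bits_def read_weights_def
      read_header_def weight_addr_def bit_addr_def For_def)

section \<open>Execution of the program on tables of numbers\<close>

definition rep :: "nat \<Rightarrow> 'b list \<Rightarrow> 'b list" where
  "rep k xs = concat (replicate k xs)"

lemma rep_0 [simp]: "rep 0 xs = []"
  by (simp add: rep_def)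

lemma rep_Suc: "rep (Suc k) xs = rep k xs @ xs"
  by (simp add: rep_def flip: replicate_append_same)

lemma pair_index_eq:
  fixes i j i' j' k :: nat
  assumes "j < k" "j' < k"
  shows "i * k + j = i' * k + j' \<longleftrightarrow> i = i' \<and> j = j'"
proof
  assume *: "i * k + j = i' * k + j'"
  have "(i * k + j) div k = i" "(i' * k + j') div k = i'" using assms by auto
  then have "i = i'" using * by simp
  then show "i = i' \<and> j = j'" using * by simp
qed simp

text \<open>No game appears here; questions are positions. \<open>cube_bound\<close> covers the
  largest number written, a denominator \<open>row * col * K\<close>, and \<open>addr_bound\<close>
  the addresses of both tables. Loops over answers are bounded through the product
  \<open>na * nb\<close>.\<close>

locale regularize_run =
  fixes t n m na nb :: nat and num den :: "nat \<Rightarrow> nat \<Rightarrow> nat" and bit :: "nat \<Rightarrow> nat \<Rightarrow> nat \<Rightarrow> nat"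
    and B D :: nat
  assumes addr_bound: "2 * (Suc n * Suc m * Suc (na * nb)) + 50 \<le> 2 ^ B"
    and num_bound: "\<And>i j. i < n \<Longrightarrow> j < m \<Longrightarrow> t * n * m * num i j < 2 ^ B"
    and cube_bound: "(t * n * m) ^ 3 < 2 ^ B"
    and sum_bound: "(\<Sum>i<n. \<Sum>j<m. t * n * m * num i j div den i j) \<le> t * n * m"
    and loop_bound: "Suc n \<le> D" "Suc m \<le> D" "t * n * m \<le> D" "na * nb \<le> D"
    and m_pos: "0 < m"
begin

definition q where "q = na * nb"
definition K where "K = t * n * m"
definition M1 where "M1 = Suc m"
definition N1 where "N1 = Suc n"
definition w where "w i j = K * num i j div den i j"
definition W where "W i j = (if i < n \<and> j < m then w i j
  else if i = n \<and> j = m then K - (\<Sum>i<n. \<Sum>j<m. w i j) else 0)"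
definition lose where "lose i j c = (if i < n \<and> j < m then 1 - bit i j c else 0)"
definition row where "row i = (\<Sum>j<M1. W i j)"
definition col where "col j = (\<Sum>i<N1. W i j)"

definition wa where "wa i j = 40 + 2 * (i * M1 + j)"
definition va where "va i j c = 41 + 2 * ((i * M1 + j) * q + c)"

lemma wa_eq: "j < M1 \<Longrightarrow> j' < M1 \<Longrightarrow> wa i j = wa i' j' \<longleftrightarrow> i = i' \<and> j = j'"
  by (simp only: wa_def add_left_cancel mult_cancel1 pair_index_eq) simp

lemma va_eq: "j < M1 \<Longrightarrow> j' < M1 \<Longrightarrow> c < q \<Longrightarrow> c' < q \<Longrightarrow>
    va i j c = va i' j' c' \<longleftrightarrow> i = i' \<and> j = j' \<and> c = c'"
  by (simp only: va_def add_left_cancel mult_cancel1 pair_index_eq) simp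

lemma wa_va: "wa i j \<noteq> va i' j' c" "va i' j' c \<noteq> wa i j"
proof -
  have "even (wa i j)" "odd (va i' j' c)" by (simp_all add: wa_def va_def)
  then show "wa i j \<noteq> va i' j' c" "va i' j' c \<noteq> wa i j" by metis+
qed

lemma addr_reg [simp]: "k < 40 \<Longrightarrow> wa i j \<noteq> k" "k < 40 \<Longrightarrow> k \<noteq> wa i j"
  "k < 40 \<Longrightarrow> va i j c \<noteq> k" "k < 40 \<Longrightarrow> k \<noteq> va i j c"
  by (simp_all add: wa_def va_def)

lemma pair_less:
  assumes "i < N1" "j < M1"
  shows "i * M1 + j < N1 * M1"
proof -
  have "i * M1 + j < Suc i * M1" using assms by simp
  also have "\<dots> \<le> N1 * M1" using assms by (intro mult_right_mono) auto
  finally show ?thesis .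
qed

lemma triple_less:
  assumes "i < N1" "j < M1" "c < q"
  shows "(i * M1 + j) * q + c < N1 * M1 * q"
proof -
  have "(i * M1 + j) * q + c < Suc (i * M1 + j) * q" using assms by simp
  also have "\<dots> \<le> N1 * M1 * q" using pair_less[OF assms(1,2)] by (intro mult_right_mono) auto
  finally show ?thesis .
qed

lemma bounds: "2 * (N1 * M1) + 2 * (N1 * M1 * q) + 50 \<le> 2 ^ B"
  using addr_bound by (simp add: N1_def M1_def q_def algebra_simps)

lemma small_bounds: "N1 < 2 ^ B" "M1 < 2 ^ B" "q < 2 ^ B" "n < 2 ^ B" "m < 2 ^ B"
proof -
  have "1 * M1 \<le> N1 * M1" "N1 * 1 \<le> N1 * M1" "1 * q \<le> N1 * M1 * q"
    by (intro mult_le_mono; simp add: N1_def M1_def)+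
  moreover have "n < N1" "m < M1" by (simp_all add: N1_def M1_def)
  ultimately show "N1 < 2 ^ B" "M1 < 2 ^ B" "q < 2 ^ B" "n < 2 ^ B" "m < 2 ^ B"
    using bounds by linarith+
qed

lemma K_bounds: "K < 2 ^ B" "a \<le> K \<Longrightarrow> b \<le> K \<Longrightarrow> a * b < 2 ^ B" "a \<le> K \<Longrightarrow> b \<le> K \<Longrightarrow> a * b * K < 2 ^ B"
proof -
  show *: "a * b * K < 2 ^ B" if "a \<le> K" "b \<le> K" for a b
  proof -
    have "a * b * K \<le> K * K * K" using that by (intro mult_le_mono) auto
    also have "\<dots> < 2 ^ B" using cube_bound by (simp add: K_def power3_eq_cube)
    finally show ?thesis .
  qed
  have "K * K < 2 ^ B" using *[of K K] by (cases "K = 0") (auto intro: le_less_trans[of _ "K * K * K"])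
  then show "K < 2 ^ B" by (cases "K = 0") (auto intro: le_less_trans[of _ "K * K"])
  show "a * b < 2 ^ B" if "a \<le> K" "b \<le> K"
    using mult_le_mono[OF that] \<open>K * K < 2 ^ B\<close> by linarith
qed

lemma wp_weight_addr:
  assumes "Q (s(22 := wa i j), inp, out)"
    and "s a = i" "s b = j" "s 6 = M1" "i < N1" "j < M1" "b \<noteq> 22"
  shows "wp B D (weight_addr a b) Q (s, inp, out)"
proof -
  have "wa i j = (i * M1 + j) * 2 + 40" by (simp add: wa_def)
  moreover note double_bounds(2-4)[OF bounds disjI1[OF pair_less[OF assms(5,6)]]]
  moreover from this(3) have "i * M1 < 2 ^ B" by (rule add_lessD1)
  ultimately have "wp B D (weight_addr a b) (\<lambda>\<sigma>. \<sigma> = (s(22 := wa i j), inp, out)) (s, inp, out)"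
    unfolding weight_addr_def using assms(2-)
    by (intro wp_Seq wp_Assign) (auto simp del: distrib_right_numeral)
  then show ?thesis by (rule wp_mono) (use assms(1) in simp)
qed

lemma wp_bit_addr:
  assumes "Q (s(22 := va i j k), inp, out)"
    and "s a = i" "s b = j" "s c = k" "s 6 = M1" "s 4 = q" "i < N1" "j < M1" "k < q" "b \<noteq> 22" "c \<noteq> 22"
  shows "wp B D (bit_addr a b c) Q (s, inp, out)"
proof -
  have "va i j k = ((i * M1 + j) * q + k) * 2 + 41" by (simp add: va_def)
  moreover note double_bounds(1,3,4)[OF bounds disjI2[OF triple_less[OF assms(7,8,9)]]]
  moreover from this(3) have "(i * M1 + j) * q < 2 ^ B" by (rule add_lessD1)
  moreover note double_bounds(4)[OF bounds disjI1[OF pair_less[OF assms(7,8)]]]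
  moreover from this have "i * M1 < 2 ^ B" by (rule add_lessD1)
  ultimately have "wp B D (bit_addr a b c) (\<lambda>\<sigma>. \<sigma> = (s(22 := va i j k), inp, out)) (s, inp, out)"
    unfolding bit_addr_def using assms(2-)
    by (intro wp_Seq wp_Assign) (auto simp del: distrib_right_numeral)
  then show ?thesis by (rule wp_mono) (use assms(1) in simp)
qed

definition scal :: "store \<Rightarrow> bool" where
  "scal s \<longleftrightarrow> s 0 = n \<and> s 1 = m \<and> s 2 = na \<and> s 3 = nb \<and> s 4 = q \<and> s 5 = K \<and> s 6 = M1 \<and> s 7 = N1"

definition arrW :: "(nat \<Rightarrow> nat \<Rightarrow> nat) \<Rightarrow> store \<Rightarrow> bool" where
  "arrW f s \<longleftrightarrow> (\<forall>i<N1. \<forall>j<M1. s (wa i j) = f i j)"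

definition arrV :: "(nat \<Rightarrow> nat \<Rightarrow> nat \<Rightarrow> nat) \<Rightarrow> store \<Rightarrow> bool" where
  "arrV f s \<longleftrightarrow> (\<forall>i<N1. \<forall>j<M1. \<forall>c<q. s (va i j c) = f i j c)"

lemma scal_upd [simp]: "8 \<le> k \<Longrightarrow> scal (s(k := v)) = scal s"
  by (auto simp: scal_def)

lemma scal_sel:
  assumes "scal s"
  shows "s 0 = n" "s 1 = m" "s (Suc 0) = m" "s 2 = na" "s 3 = nb" "s 4 = q" "s 5 = K" "s 6 = M1" "s 7 = N1"
  using assms by (auto simp: scal_def)

lemma wa_ge [simp]: "8 \<le> wa i j" "8 \<le> va i j c"
  by (simp_all add: wa_def va_def)

lemma arr_upd [simp]:
  "k < 40 \<Longrightarrow> arrW f (s(k := v)) = arrW f s" "k < 40 \<Longrightarrow> arrV g (s(k := v)) = arrV g s"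
  "arrW f (s(va i j c := v)) = arrW f s" "arrV g (s(wa i j := v)) = arrV g s"
  by (auto simp: arrW_def arrV_def wa_va)

text \<open>The state after reading. The writing phase changes only registers from 8 to 39 and so
  preserves it.\<close>

definition mem :: "store \<Rightarrow> bool" where
  "mem s \<longleftrightarrow> scal s \<and> arrW W s \<and> arrV lose s"

lemma mem_upd [simp]: "8 \<le> k \<Longrightarrow> k < 40 \<Longrightarrow> mem (s(k := v)) = mem s"
  by (simp add: mem_def)

lemma mem_sel:
  assumes "mem s"
  shows "s 0 = n" "s 1 = m" "s (Suc 0) = m" "s 2 = na" "s 3 = nb" "s 4 = q" "s 5 = K" "s 6 = M1" "s 7 = N1"
    "i < N1 \<Longrightarrow> j < M1 \<Longrightarrow> s (wa i j) = W i j"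
    "i < N1 \<Longrightarrow> j < M1 \<Longrightarrow> c < q \<Longrightarrow> s (va i j c) = lose i j c"
  using assms by (auto simp: mem_def scal_def arrW_def arrV_def)


lemma W_sum: "(\<Sum>i<N1. \<Sum>j<M1. W i j) = K"
proof -
  have "(\<Sum>j<M1. W i j) = (\<Sum>j<m. w i j)" if "i < n" for i
    using that by (simp add: M1_def W_def)
  moreover have "(\<Sum>j<M1. W n j) = K - (\<Sum>i<n. \<Sum>j<m. w i j)"
    by (simp add: M1_def W_def)
  ultimately show ?thesis
    using sum_bound by (simp add: N1_def K_def w_def)
qed

text \<open>Partial sums are the intermediate values of the accumulator, each of which has to fit
  into \<open>B\<close> bits.\<close>

lemma W_partial_row: "i < N1 \<Longrightarrow> k \<le> M1 \<Longrightarrow> (\<Sum>j<k. W i j) \<le> K"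
proof -
  assume "i < N1" "k \<le> M1"
  have "(\<Sum>j<k. W i j) \<le> (\<Sum>j<M1. W i j)"
    using \<open>k \<le> M1\<close> by (intro sum_mono2) auto
  also have "\<dots> \<le> (\<Sum>i<N1. \<Sum>j<M1. W i j)"
    using \<open>i < N1\<close> by (intro member_le_sum) auto
  finally show ?thesis by (simp add: W_sum)
qed

lemma W_partial_col: "j < M1 \<Longrightarrow> k \<le> N1 \<Longrightarrow> (\<Sum>i<k. W i j) \<le> K"
proof -
  assume "j < M1" "k \<le> N1"
  have "(\<Sum>i<k. W i j) \<le> (\<Sum>i<N1. W i j)"
    using \<open>k \<le> N1\<close> by (intro sum_mono2) auto
  also have "\<dots> \<le> (\<Sum>i<N1. \<Sum>j<M1. W i j)"
    using \<open>j < M1\<close> by (intro sum_mono member_le_sum) auto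
  finally show ?thesis by (simp add: W_sum)
qed

lemma row_le: "i < N1 \<Longrightarrow> row i \<le> K" and col_le: "j < M1 \<Longrightarrow> col j \<le> K"
  by (simp_all add: row_def col_def W_partial_row W_partial_col)

lemma loop_bounds: "N1 \<le> D" "M1 \<le> D" "K \<le> D" "q \<le> D" "n \<le> D" "m \<le> D"
  using loop_bound by (simp_all add: N1_def M1_def K_def q_def)

definition agree :: "nat set \<Rightarrow> store \<Rightarrow> store \<Rightarrow> bool" where
  "agree Z s s' \<longleftrightarrow> (\<forall>r. r \<notin> Z \<longrightarrow> s' r = s r)"

lemma agree_upd [simp]: "r \<in> Z \<Longrightarrow> agree Z s (s'(r := v)) = agree Z s s'"
  by (auto simp: agree_def)

lemma agree_refl [simp]: "agree Z s s"
  by (simp add: agree_def)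

lemma mem_agree: "agree Z s s' \<Longrightarrow> Z \<subseteq> {8..<40} \<Longrightarrow> mem s \<Longrightarrow> mem s'"
proof -
  assume *: "agree Z s s'" "Z \<subseteq> {8..<40}" "mem s"
  then have "s' r = s r" if "r < 8 \<or> 40 \<le> r" for r
    using that by (auto simp: agree_def subset_iff)
  moreover have "40 \<le> wa i j" "40 \<le> va i j k" for i j k by (simp_all add: wa_def va_def)
  ultimately show ?thesis using *(3) by (simp add: mem_def scal_def arrW_def arrV_def)
qed

lemma wp_row_sum:
  assumes "mem s" "s 10 = i" "i < N1" "s 23 = 0"
    and Q: "\<And>s'. agree {22, 23, 12, 13} s s' \<Longrightarrow> s' 23 = row i \<Longrightarrow> Q (s', inp, out)"
  shows "wp B D (For 12 13 (reg 6) (Seq (weight_addr 10 12) (Assign (Dir 23) Add (reg 23) (ind 22))))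
    Q (s, inp, out)"
proof (rule wp_For[where n = M1 and I = "\<lambda>k (s', inp', out'). inp' = inp \<and> out' = out \<and>
    agree {22, 23, 12, 13} s s' \<and> s' 23 = (\<Sum>j<k. W i j)"], goal_cases)
  \<comment> \<open>In every use of \<open>wp_For\<close>, case 6 is the entry of the loop, case 7
    one pass of the body and case 8 the exit.\<close>
  case (7 k s' inp' out')
  then have s': "mem s'" "s' 10 = i" and k: "k < M1" and acc: "s' 23 = (\<Sum>j<k. W i j)"
    using assms mem_agree[of "{22, 23, 12, 13}" s s'] by (auto simp: agree_def)
  have "(\<Sum>j<k. W i j) + W i k < 2 ^ B"
    using W_partial_row[OF \<open>i < N1\<close>, of "Suc k"] k K_bounds(1) by simp
  then show ?case
    using 7 assms(3) s' k acc
    by (intro wp_Seq wp_weight_addr[where i = i and j = k] wp_Assign) (auto simp: mem_sel)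
qed (use assms loop_bounds small_bounds in \<open>auto simp: mem_sel row_def\<close>)

lemma wp_col_sum:
  assumes "mem s" "s 12 = j" "j < M1" "s 24 = 0"
    and Q: "\<And>s'. agree {22, 24, 18, 19} s s' \<Longrightarrow> s' 24 = col j \<Longrightarrow> Q (s', inp, out)"
  shows "wp B D (For 18 19 (reg 7) (Seq (weight_addr 18 12) (Assign (Dir 24) Add (reg 24) (ind 22))))
    Q (s, inp, out)"
proof (rule wp_For[where n = N1 and I = "\<lambda>k (s', inp', out'). inp' = inp \<and> out' = out \<and>
    agree {22, 24, 18, 19} s s' \<and> s' 24 = (\<Sum>i<k. W i j)"], goal_cases)
  case (7 k s' inp' out')
  then have s': "mem s'" "s' 12 = j" and k: "k < N1" and acc: "s' 24 = (\<Sum>i<k. W i j)"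
    using assms mem_agree[of "{22, 24, 18, 19}" s s'] by (auto simp: agree_def)
  have "(\<Sum>i<k. W i j) + W k j < 2 ^ B"
    using W_partial_col[OF \<open>j < M1\<close>, of "Suc k"] k K_bounds(1) by simp
  then show ?case
    using 7 assms(3) s' k acc
    by (intro wp_Seq wp_weight_addr[where i = k and j = j] wp_Assign) (auto simp: mem_sel)
qed (use assms loop_bounds small_bounds in \<open>auto simp: mem_sel col_def\<close>)

definition table_row :: "(nat \<Rightarrow> nat \<Rightarrow> nat list) \<Rightarrow> nat \<Rightarrow> nat \<Rightarrow> nat list" where
  "table_row f i y = concat (map (\<lambda>j. rep (col j) (f i j)) [0..<y])"

definition table_output :: "(nat \<Rightarrow> nat \<Rightarrow> nat list) \<Rightarrow> nat \<Rightarrow> nat list" where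
  "table_output f x = concat (map (\<lambda>i. rep (row i) (table_row f i M1)) [0..<x])"

text \<open>Every invariant carries the counters and sums of the loops around it, because
  \<open>wp_For\<close> itself keeps track of its own two counters only; the command
  \<open>c\<close> is confined to five scratch registers.\<close>

lemma wp_table:
  assumes body: "\<And>i j s inp out. i < N1 \<Longrightarrow> j < M1 \<Longrightarrow> mem s \<Longrightarrow> s 10 = i \<Longrightarrow> s 12 = j \<Longrightarrow> s 23 = row i \<Longrightarrow>
      s 24 = col j \<Longrightarrow>
      wp B D c (\<lambda>(s', inp', out'). mem s' \<and> agree {18, 19, 20, 22, 26} s s' \<and> inp' = inp \<and> out' = out @ f i j)
        (s, inp, out)"
    and s: "mem s"
  shows "wp B D (table c) (\<lambda>(s', inp', out'). mem s' \<and> inp' = inp \<and> out' = out @ table_output f N1) (s, inp, out)"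
  unfolding table_def
proof (rule wp_For[where n = N1 and I = "\<lambda>x (s', inp', out'). mem s' \<and> inp' = inp \<and>
    out' = out @ table_output f x"], goal_cases)
  case (7 x s1 inp1 out1)
  note s1 = this
  show ?case
  proof (intro wp_Seq wp_Assign wp_row_sum[where i = x], goal_cases)
    case (5 s2)
    have s2: "mem s2" "s2 10 = x" "s2 11 = N1 - x" "s2 23 = row x"
      using 5 s1 mem_agree[OF 5(1)] by (auto simp: agree_def)
    show ?case
    proof (rule wp_For[where n = "row x" and I = "\<lambda>k (s', inp', out'). mem s' \<and> inp' = inp \<and>
        out' = out1 @ rep k (table_row f x M1) \<and> s' 10 = x \<and> s' 11 = N1 - x \<and> s' 23 = row x"], goal_cases)
      case (7 k s3 inp3 out3)
      note s3 = this
      show ?case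
      proof (rule wp_For[where n = M1 and I = "\<lambda>y (s', inp', out'). mem s' \<and> inp' = inp \<and>
          out' = out3 @ table_row f x y \<and> s' 10 = x \<and> s' 11 = N1 - x \<and> s' 23 = row x \<and>
          s' 14 = k \<and> s' 15 = row x - k"], goal_cases)
        case (7 y s4 inp4 out4)
        note s4 = this
        show ?case
        proof (intro wp_Seq wp_Assign wp_col_sum[where j = y], goal_cases)
          case (5 s5)
          have s5: "mem s5" "s5 10 = x" "s5 11 = N1 - x" "s5 23 = row x" "s5 14 = k" "s5 15 = row x - k"
              "s5 12 = y" "s5 13 = M1 - y" "s5 24 = col y"
            using 5 s4 mem_agree[OF 5(1)] by (auto simp: agree_def)
          show ?case
          proof (rule wp_For[where n = "col y" and I = "\<lambda>l (s', inp', out'). mem s' \<and> inp' = inp \<and>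
              out' = out4 @ rep l (f x y) \<and> s' 10 = x \<and> s' 11 = N1 - x \<and> s' 23 = row x \<and>
              s' 14 = k \<and> s' 15 = row x - k \<and> s' 12 = y \<and> s' 13 = M1 - y \<and> s' 24 = col y"], goal_cases)
            case (7 l s6 inp6 out6)
            show ?case
              by (rule wp_mono[OF body[of x y]])
                (use 7 s1(1) s4(1) in \<open>auto simp: agree_def rep_Suc\<close>)
          qed (use s4 s5 col_le[OF s4(1)] loop_bounds K_bounds(1) in \<open>auto simp: table_row_def\<close>)
        qed (use s4 in auto)
      qed (use s3 loop_bounds small_bounds in \<open>auto simp: mem_sel table_row_def rep_Suc\<close>)
    qed (use s1 s2 row_le[OF s1(1)] loop_bounds K_bounds(1) in \<open>auto simp: table_output_def\<close>)
  qed (use s1 in auto)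
qed (use s loop_bounds small_bounds in \<open>auto simp: mem_sel table_output_def\<close>)

lemma wp_write_weight:
  assumes "i < N1" "j < M1" "mem s" "s 10 = i" "s 12 = j" "s 23 = row i" "s 24 = col j"
  shows "wp B D write_weight (\<lambda>(s', inp', out'). mem s' \<and> agree {18, 19, 20, 22, 26} s s' \<and> inp' = inp \<and>
    out' = out @ [W i j, row i * col j * K]) (s, inp, out)"
  unfolding write_weight_def
  using assms K_bounds(2,3)[OF row_le col_le, OF assms(1,2)]
  by (intro wp_Seq wp_weight_addr[where i = i and j = j] wp_Assign wp_Write) (auto simp: mem_sel)

lemma wp_write_bits:
  assumes "i < N1" "j < M1" "mem s" "s 10 = i" "s 12 = j"
  shows "wp B D write_bits (\<lambda>(s', inp', out'). mem s' \<and> agree {18, 19, 20, 22, 26} s s' \<and> inp' = inp \<and>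
    out' = out @ map (\<lambda>c. 1 - lose i j c) [0..<q]) (s, inp, out)"
  unfolding write_bits_def
proof (rule wp_For[where n = q and I = "\<lambda>k (s', inp', out'). mem s' \<and> agree {18, 19, 20, 22, 26} s s' \<and> inp' = inp \<and>
    out' = out @ map (\<lambda>c. 1 - lose i j c) [0..<k]"], goal_cases)
  case (7 k s' inp' out')
  then have "s' 10 = i" "s' 12 = j" using assms by (auto simp: agree_def)
  then show ?case
    using 7 assms
    by (intro wp_Seq wp_bit_addr[where i = i and j = j and k = k] wp_Assign wp_Write) (auto simp: mem_sel)
qed (use assms loop_bounds small_bounds in \<open>auto simp: mem_sel\<close>)

lemma wp_table_weights:
  "mem s \<Longrightarrow> wp B D (table write_weight) (\<lambda>(s', inp', out'). mem s' \<and> inp' = inp \<and>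
    out' = out @ table_output (\<lambda>i j. [W i j, row i * col j * K]) N1) (s, inp, out)"
  by (rule wp_table, rule wp_write_weight)

lemma wp_table_bits:
  "mem s \<Longrightarrow> wp B D (table write_bits) (\<lambda>(s', inp', out'). mem s' \<and> inp' = inp \<and>
    out' = out @ table_output (\<lambda>i j. map (\<lambda>c. 1 - lose i j c) [0..<q]) N1) (s, inp, out)"
  by (rule wp_table, rule wp_write_bits)

section \<open>The reading phase; the codes from row \<open>i\<close> on are the unread
  input\<close>

definition weights_code where
  "weights_code i = concat (map (\<lambda>i. concat (map (\<lambda>j. [num i j, den i j]) [0..<m])) [i..<n])"

definition bits_code where
  "bits_code i = concat (map (\<lambda>i. concat (map (\<lambda>j. map (bit i j) [0..<q]) [0..<m])) [i..<n])"

text \<open>The table after the pairs lexicographically before \<open>(i, j)\<close> have been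
  read.\<close>

definition partial_weights where
  "partial_weights i j i' j' = (if j' < m \<and> (i' < i \<or> i' = i \<and> j' < j) then w i' j' else 0)"

definition partial_lose where
  "partial_lose i j c i' j' c' =
     (if j' < m \<and> (i' < i \<or> i' = i \<and> (j' < j \<or> j' = j \<and> c' < c)) then 1 - bit i' j' c' else 0)"

lemma partial_weights_simps:
  "partial_weights i m = partial_weights (Suc i) 0" "partial_weights 0 0 = (\<lambda>_ _. 0)"
  by (auto simp: partial_weights_def fun_eq_iff less_Suc_eq)

lemma partial_lose_simps:
  "partial_lose i j q i' j' c = (if c < q then partial_lose i (Suc j) 0 i' j' c else partial_lose i j q i' j' c)"
  "partial_lose i m 0 = partial_lose (Suc i) 0 0" "partial_lose 0 0 0 = (\<lambda>_ _ _. 0)"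
  by (auto simp: partial_lose_def fun_eq_iff less_Suc_eq)

text \<open>The two functions may differ at indices \<open>c \<ge> q\<close>, but the array stores
  only those below \<open>q\<close>.\<close>

lemma arrV_partial_lose: "arrV (partial_lose i j q) s = arrV (partial_lose i (Suc j) 0) s"
  unfolding arrV_def by (intro iff_allI imp_cong refl) (simp add: partial_lose_simps(1))

lemma arrW_write:
  "arrW (partial_weights i j) s \<Longrightarrow> i < n \<Longrightarrow> j < m \<Longrightarrow> v = w i j \<Longrightarrow>
    arrW (partial_weights i (Suc j)) (s(wa i j := v))"
  by (auto simp: arrW_def partial_weights_def wa_eq M1_def less_Suc_eq)

lemma arrV_write:
  "arrV (partial_lose i j c) s \<Longrightarrow> i < n \<Longrightarrow> j < m \<Longrightarrow> c < q \<Longrightarrow> v = 1 - bit i j c \<Longrightarrow>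
    arrV (partial_lose i j (Suc c)) (s(va i j c := v))"
  by (auto simp: arrV_def partial_lose_def va_eq M1_def less_Suc_eq)

lemma less_N1_M1: "i < n \<Longrightarrow> i < N1" "j < m \<Longrightarrow> j < M1" "n < N1" "m < M1"
  by (simp_all add: N1_def M1_def)

lemma wp_read_weights:
  assumes "scal s" "arrW (\<lambda>_ _. 0) s" "arrV (\<lambda>_ _ _. 0) s" "s 8 = K" "inp = weights_code 0 @ rest"
  shows "wp B D read_weights (\<lambda>(s', inp', out'). scal s' \<and> arrW W s' \<and> arrV (\<lambda>_ _ _. 0) s' \<and>
    inp' = rest \<and> out' = out) (s, inp, out)"
  unfolding read_weights_def
proof (rule wp_Seq, rule wp_For[where n = n and I = "\<lambda>i (s', inp', out'). scal s' \<and> arrW (partial_weights i 0) s' \<and>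
    arrV (\<lambda>_ _ _. 0) s' \<and> s' 8 = K - (\<Sum>i<i. \<Sum>j<m. w i j) \<and> inp' = weights_code i @ rest \<and> out' = out"], goal_cases)
  case (7 i s1 inp1 out1)
  note s1 = this
  show ?case
  proof (rule wp_For[where n = m and I = "\<lambda>j (s', inp', out'). scal s' \<and> arrW (partial_weights i j) s' \<and>
      arrV (\<lambda>_ _ _. 0) s' \<and> s' 8 = K - ((\<Sum>i<i. \<Sum>j<m. w i j) + (\<Sum>j<j. w i j)) \<and>
      inp' = concat (map (\<lambda>j. [num i j, den i j]) [j..<m]) @ weights_code (Suc i) @ rest \<and> out' = out \<and>
      s' 10 = i \<and> s' 11 = n - i"], goal_cases)
    case (7 j s2 inp2 out2)
    note s2 = this
    have inp2: "inp2 = num i j # den i j # concat (map (\<lambda>j. [num i j, den i j]) [Suc j..<m]) @ weights_code (Suc i) @ rest"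
      using s2(1,2) by (simp add: upt_conv_Cons)
    have numK: "K * num i j < 2 ^ B"
      using num_bound[of i j] s1(1) s2(1) by (simp add: K_def)
    have wK: "w i j < 2 ^ B"
      unfolding w_def using numK by (rule le_less_trans[OF div_le_dividend])
    show ?case
      unfolding inp2 using s1(1) s2 numK wK
      by (intro wp_Seq wp_Read wp_weight_addr[where i = i and j = j] wp_Assign)
        (auto simp: scal_sel less_N1_M1 w_def[symmetric] intro!: arrW_write)
  next
    case 6
    then show ?case using s1 by (auto simp: weights_code_def upt_conv_Cons)
  qed (use s1 loop_bounds small_bounds in \<open>auto simp: scal_sel partial_weights_simps add.commute\<close>)
next
  \<comment> \<open>Row \<open>n\<close> and column \<open>m\<close> still hold 0, as
    \<open>W\<close> requires, except for the additional pair, which now receives the remaining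
    weight.\<close>
  case (8 s1 inp1 out1)
  have "arrW W (s1(22 := wa n m, wa n m := K - (\<Sum>i<n. \<Sum>j<m. w i j)))"
    using 8 by (auto simp: arrW_def W_def partial_weights_def wa_eq N1_def M1_def less_Suc_eq)
  then show ?case
    using 8 by (intro wp_Seq wp_weight_addr[where i = n and j = m] wp_Assign) 
      (auto simp: scal_sel less_N1_M1 weights_code_def intro: le_less_trans[OF diff_le_self K_bounds(1)])
qed (use assms loop_bounds small_bounds in \<open>auto simp: scal_sel partial_weights_simps\<close>)

lemma one_bound: "Suc 0 - x < 2 ^ B"
  using small_bounds(1) by (simp add: N1_def)

lemma wp_read_bits:
  assumes "scal s" "arrW W s" "arrV (\<lambda>_ _ _. 0) s" "inp = bits_code 0"
  shows "wp B D read_bits (\<lambda>(s', inp', out'). mem s' \<and> out' = out) (s, inp, out)"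
  unfolding read_bits_def
proof (rule wp_For[where n = n and I = "\<lambda>i (s', inp', out'). scal s' \<and> arrW W s' \<and>
    arrV (partial_lose i 0 0) s' \<and> inp' = bits_code i \<and> out' = out"], goal_cases)
  case (7 i s1 inp1 out1)
  note s1 = this
  show ?case
  proof (rule wp_For[where n = m and I = "\<lambda>j (s', inp', out'). scal s' \<and> arrW W s' \<and>
    arrV (partial_lose i j 0) s' \<and> inp' = concat (map (\<lambda>j. map (bit i j) [0..<q]) [j..<m]) @ bits_code (Suc i) \<and>
    out' = out \<and> s' 10 = i \<and> s' 11 = n - i"], goal_cases)
    case (7 j s2 inp2 out2)
    note s2 = this
    show ?case
    proof (rule wp_For[where n = q and I = "\<lambda>c (s', inp', out'). scal s' \<and> arrW W s' \<and>
      arrV (partial_lose i j c) s' \<and> inp' = map (bit i j) [c..<q] @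
        concat (map (\<lambda>j. map (bit i j) [0..<q]) [Suc j..<m]) @ bits_code (Suc i) \<and>
      out' = out \<and> s' 10 = i \<and> s' 11 = n - i \<and> s' 12 = j \<and> s' 13 = m - j"], goal_cases)
      case (7 c s3 inp3 out3)
      note s3 = this
      have inp3: "inp3 = bit i j c # map (bit i j) [Suc c..<q] @
        concat (map (\<lambda>j. map (bit i j) [0..<q]) [Suc j..<m]) @ bits_code (Suc i)"
        using s3(1,2) by (simp add: upt_conv_Cons)
      show ?case
        unfolding inp3 using s1(1) s2(1) s3
        by (intro wp_Seq wp_Read wp_bit_addr[where i = i and j = j and k = c] wp_Assign)
          (auto simp: scal_sel less_N1_M1 one_bound intro!: arrV_write)
    next
      case 6
      then show ?case using s2 by (auto simp: upt_conv_Cons)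
    qed (use s2 loop_bounds small_bounds in \<open>auto simp: scal_sel arrV_partial_lose\<close>)
  next
    case 6
    then show ?case using s1 by (auto simp: bits_code_def upt_conv_Cons)
  qed (use s1 loop_bounds small_bounds in \<open>auto simp: scal_sel partial_lose_simps(2)\<close>)
next
  \<comment> \<open>The cells of row \<open>n\<close> and column \<open>m\<close> still hold 0, the
    complemented bit of a win.\<close>
  case (8 s1 inp1 out1)
  then show ?case
    by (auto simp: mem_def arrV_def partial_lose_def lose_def N1_def M1_def less_Suc_eq)
qed (use assms loop_bounds small_bounds in \<open>auto simp: scal_sel partial_lose_simps\<close>)

lemma wp_read_header:
  assumes "s = (\<lambda>_. 0)" "inp = [n, m, na, nb] @ rest"
  shows "wp B D (read_header t) (\<lambda>(s', inp', out'). scal s' \<and> arrW (\<lambda>_ _. 0) s' \<and> arrV (\<lambda>_ _ _. 0) s' \<and> s' 8 = K \<and>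
    inp' = rest \<and> out' = out) (s, inp, out)"
proof -
  \<comment> \<open>The scale is multiplied up factor by factor; by \<open>0 < m\<close> the partial
    product is at most \<open>K\<close>.\<close>
  have "t * n < 2 ^ B"
    using K_bounds(1) m_pos le_less_trans[of "t * n" "t * n * m"] by (simp add: K_def)
  then show ?thesis
    unfolding read_header_def assms using small_bounds K_bounds(1)
    by (simp, intro wp_Seq wp_Read wp_Assign)
      (auto simp: scal_def arrW_def arrV_def q_def K_def N1_def M1_def)
qed

lemma wp_regularize:
  "wp B D (regularize t) (\<lambda>(s, inp, out). out = [K, K, na, nb] @
      table_output (\<lambda>i j. [W i j, row i * col j * K]) N1 @
      table_output (\<lambda>i j. map (\<lambda>c. 1 - lose i j c) [0..<q]) N1)
    ((\<lambda>_. 0), [n, m, na, nb] @ weights_code 0 @ bits_code 0, [])"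
  unfolding regularize_def
proof (intro wp_Seq wp_mono[OF wp_read_header[OF refl refl]], goal_cases)
  case (1 \<sigma>1)
  obtain s1 where s1: "\<sigma>1 = (s1, weights_code 0 @ bits_code 0, [])" and *: "scal s1" "arrW (\<lambda>_ _. 0) s1"
    "arrV (\<lambda>_ _ _. 0) s1" "s1 8 = K" using 1(2) by (cases \<sigma>1) auto
  show ?case unfolding s1
  proof (intro wp_Seq wp_mono[OF wp_read_weights[OF * refl]], goal_cases)
    case (1 \<sigma>2)
    obtain s2 where s2: "\<sigma>2 = (s2, bits_code 0, [])" and *: "scal s2" "arrW W s2"
      "arrV (\<lambda>_ _ _. 0) s2" using 1(2) by (cases \<sigma>2) auto
    show ?case unfolding s2
    proof (intro wp_Seq wp_mono[OF wp_read_bits[OF * refl]], goal_cases)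
      case (1 \<sigma>3)
      obtain s3 inp3 where s3: "\<sigma>3 = (s3, inp3, [])" and mem3: "mem s3" using 1(2) by (cases \<sigma>3) auto
      have "wp B D (Seq (table write_weight) (table write_bits)) (\<lambda>(s, inp, out). out = [K, K, na, nb] @
          table_output (\<lambda>i j. [W i j, row i * col j * K]) N1 @
          table_output (\<lambda>i j. map (\<lambda>c. 1 - lose i j c) [0..<q]) N1) (s3, inp3, [K, K, na, nb])"
      proof (rule wp_Seq, rule wp_mono[OF wp_table_weights[OF mem3]])
        fix \<sigma>4
        assume "case \<sigma>4 of (s', inp', out') \<Rightarrow> mem s' \<and> inp' = inp3 \<and>
          out' = [K, K, na, nb] @ table_output (\<lambda>i j. [W i j, row i * col j * K]) N1"
        then obtain s4 where s4: "\<sigma>4 = (s4, inp3, [K, K, na, nb] @ table_output (\<lambda>i j. [W i j, row i * col j * K]) N1)"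
          and mem4: "mem s4"
          by (cases \<sigma>4) auto
        show "wp B D (table write_bits) (\<lambda>(s, inp, out). out = [K, K, na, nb] @
          table_output (\<lambda>i j. [W i j, row i * col j * K]) N1 @
          table_output (\<lambda>i j. map (\<lambda>c. 1 - lose i j c) [0..<q]) N1) \<sigma>4"
          unfolding s4 by (rule wp_mono[OF wp_table_bits[OF mem4]]) auto
      qed
      then show ?case unfolding s3
        by (intro wp_Seq[of _ _ "Write _"] wp_Write) (use mem3 in \<open>simp add: mem_sel\<close>)
    qed
  qed
qed

end

section \<open>Codes of the regularized game\<close>

text \<open>A value that depends on the label only is constant along each block. So a table over the
  copies is a sequence of repetitions, the form in which the program writes it.\<close>

lemma concat_map_fibres:
  assumes "\<And>s u. s \<in> set xs \<Longrightarrow> u \<in> set (L s) \<Longrightarrow> lab u = s"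
  shows "concat (map (\<lambda>u. g (lab u)) (concat (map L xs))) = concat (map (\<lambda>s. rep (length (L s)) (g s)) xs)"
  using assms
proof (induction xs)
  case (Cons s xs)
  have "map (\<lambda>u. g (lab u)) (L s) = map (\<lambda>_. g s) (L s)"
    using Cons.prems by (intro map_cong) auto
  then show ?case
    using Cons by (simp add: rep_def map_replicate_const)
qed simp

lemma distinct_concat_fibres:
  assumes "\<And>s u. s \<in> set xs \<Longrightarrow> u \<in> set (L s) \<Longrightarrow> lab u = s"
    and "\<And>s. s \<in> set xs \<Longrightarrow> distinct (L s)" and "distinct xs"
  shows "distinct (concat (map L xs))"
  using assms
proof (induction xs)
  case (Cons s xs)
  have "u \<notin> set (concat (map L xs))" if "u \<in> set (L s)" for u
    using Cons.prems(1)[of s u] Cons.prems(1)[of _ u] Cons.prems(3) that by auto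
  then show ?case using Cons by (auto simp del: set_concat)
qed simp

lemma concat_concat: "concat (concat xss) = concat (map concat xss)"
  by (induction xss) simp_all

lemma concat_map_nth:
  "concat (map f xs) = concat (map (\<lambda>i. f (xs ! i)) [0..<length xs])"
proof -
  have "map f xs = map f (map ((!) xs) [0..<length xs])" by (simp only: map_nth)
  then show ?thesis by (simp add: comp_def)
qed

lemma sum_nth:
  assumes "distinct xs"
  shows "(\<Sum>i<length xs. f (xs ! i)) = sum f (set xs)"
  using sum.reindex_bij_betw[OF bij_betw_nth[OF assms refl refl], of f] .

context integer_weights
begin

text \<open>A code may list the questions in any order. This order arranges the copies in blocks
  that follow the given listing of the original questions.\<close>

definition listX :: "'s list \<Rightarrow> nat list" where
  "listX xs = concat (map (\<lambda>s. sorted_list_of_set (fibX s)) xs)"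

definition listY :: "'r list \<Rightarrow> nat list" where
  "listY ys = concat (map (\<lambda>r. sorted_list_of_set (fibY r)) ys)"

lemma listX:
  assumes "distinct xs" "set xs = S"
  shows "distinct (listX xs)" "set (listX xs) = {..<total}"
proof -
  show "distinct (listX xs)"
    unfolding listX_def using assms
    by (intro distinct_concat_fibres[where lab = labX]) (auto simp: fibX_def)
  show "set (listX xs) = {..<total}"
    using assms labX_in by (auto simp: listX_def fibX_def)
qed

lemma listY:
  assumes "distinct ys" "set ys = R"
  shows "distinct (listY ys)" "set (listY ys) = {..<total}"
proof -
  show "distinct (listY ys)"
    unfolding listY_def using assms
    by (intro distinct_concat_fibres[where lab = labY]) (auto simp: fibY_def)
  show "set (listY ys) = {..<total}"
    using assms labY_in by (auto simp: listY_def fibY_def)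
qed

lemma concat_map_lists:
  assumes "set xs = S" "set ys = R"
  shows "concat (map (\<lambda>u. concat (map (\<lambda>v. h (labX u) (labY v)) (listY ys))) (listX xs)) =
    concat (map (\<lambda>s. rep (row s) (concat (map (\<lambda>r. rep (col r) (h s r)) ys))) xs)"
proof -
  have "concat (map (\<lambda>v. h s (labY v)) (listY ys)) = concat (map (\<lambda>r. rep (col r) (h s r)) ys)" for s
  proof -
    have "concat (map (\<lambda>v. h s (labY v)) (listY ys)) =
        concat (map (\<lambda>r. rep (length (sorted_list_of_set (fibY r))) (h s r)) ys)"
      unfolding listY_def by (rule concat_map_fibres) (auto simp: fibY_def)
    also have "\<dots> = concat (map (\<lambda>r. rep (col r) (h s r)) ys)"
      using assms by (intro arg_cong[of _ _ concat] map_cong) (simp_all add: card_fibY)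
    finally show ?thesis .
  qed
  then have "concat (map (\<lambda>u. concat (map (\<lambda>v. h (labX u) (labY v)) (listY ys))) (listX xs)) =
      concat (map (\<lambda>u. concat (map (\<lambda>r. rep (col r) (h (labX u) r)) ys)) (listX xs))" by simp
  also have "\<dots> = concat (map (\<lambda>s. rep (length (sorted_list_of_set (fibX s)))
      (concat (map (\<lambda>r. rep (col r) (h s r)) ys))) xs)"
    unfolding listX_def by (rule concat_map_fibres) (auto simp: fibX_def)
  also have "\<dots> = concat (map (\<lambda>s. rep (row s) (concat (map (\<lambda>r. rep (col r) (h s r)) ys))) xs)"
    using assms by (intro arg_cong[of _ _ concat] map_cong) (simp_all add: card_fibX)
  finally show ?thesis .
qed

end

abbreviation padded_list :: "'x list \<Rightarrow> 'x option list" where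
  "padded_list xs \<equiv> map Some xs @ [None]"

context rounded_game
begin

lemma padded_list:
  "distinct xs \<Longrightarrow> distinct (padded_list xs)" "set (padded_list xs) = padded_questions (set xs)"
  by (auto simp: distinct_map)

text \<open>The listings \<open>xs\<close> and \<open>ys\<close> affect only the order in which the
  questions of the one game are listed. The denominators \<open>row * col * K\<close> are positive
  because a label that occurs has copies.\<close>

lemma encodes_regularized:
  assumes "distinct xs" "set xs = questX G" "distinct ys" "set ys = questY G"
    and "distinct as" "set as = ansA G" "distinct bs" "set bs = ansB G"
  shows "encodes_game ([K, K, length as, length bs] @
      concat (map (\<lambda>s. rep (row s) (concat (map (\<lambda>r. rep (col r) [padded_weight K G s r, row s * col r * K])
        (padded_list ys)))) (padded_list xs)) @
      concat (map (\<lambda>s. rep (row s) (concat (map (\<lambda>r. rep (col r)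
        (concat (map (\<lambda>a. map (\<lambda>b. of_bool (padded_win G a b s r)) bs) as)))
        (padded_list ys)))) (padded_list xs))) (regularized t G)"
proof -
  let ?us = "listX (padded_list xs)" and ?vs = "listY (padded_list ys)"
  have us: "distinct ?us" "set ?us = {..<K}" and vs: "distinct ?vs" "set ?vs = {..<K}"
    using listX[OF padded_list(1), of xs] listY[OF padded_list(1), of ys] assms
    by (simp_all add: total_eq)
  have len: "length ?us = K" "length ?vs = K"
    using distinct_card[OF us(1)] distinct_card[OF vs(1)] us(2) vs(2) by simp_all
  note lists = concat_map_lists[of "padded_list xs" "padded_list ys", unfolded padded_list(2) assms, OF refl refl, symmetric]
  show ?thesis
    unfolding encodes_game_def lists regularized_sel
    apply (rule exI[of _ ?us], rule exI[of _ ?vs], rule exI[of _ as], rule exI[of _ bs],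
       rule exI[of _ "\<lambda>u v. padded_weight K G (labX u) (labY v)"], rule exI[of _ "\<lambda>u v. row (labX u) * col (labY v) * K"])
    using us vs len assms row_pos col_pos K_pos
    by (simp add: pmf_blowup total_eq mult_ac concat_concat map_concat comp_def)
qed

definition answers_code :: "'a list \<Rightarrow> 'b list \<Rightarrow> 'x option \<Rightarrow> 'y option \<Rightarrow> nat list" where
  "answers_code as bs s r = concat (map (\<lambda>a. map (\<lambda>b. of_bool (padded_win G a b s r)) bs) as)"

lemma answers_code:
  "length (answers_code as bs s r) = length as * length bs"
  "set (answers_code as bs s r) \<subseteq> {0, 1}"
  "answers_code as bs None r = replicate (length as * length bs) 1"
  "answers_code as bs s None = replicate (length as * length bs) 1"
proof -
  show len: "length (answers_code as bs s r) = length as * length bs" for s r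
    by (simp add: answers_code_def length_concat comp_def sum_list_triv)
  show "set (answers_code as bs s r) \<subseteq> {0, 1}" by (auto simp: answers_code_def)
  show "answers_code as bs None r = replicate (length as * length bs) 1"
    by (rule replicate_eqI) (auto simp: len, auto simp: answers_code_def split: if_splits)
  show "answers_code as bs s None = replicate (length as * length bs) 1"
    by (rule replicate_eqI) (auto simp: len, auto simp: answers_code_def split: if_splits)
qed

lemma regularize_correct:
  fixes ws :: "nat list"
  defines "S \<equiv> code_size ws"
  assumes "encodes_game ws G"
  shows "\<exists>s inp ws' t'. exec (regularize t) (\<lambda>_. 0, ws, []) t' (s, inp, ws') \<and>
    t' \<le> steps (1 + (t + 1) * S) (regularize t) * (10 * (3 * S + 3 * t + 6)) \<and>
    encodes_game ws' (regularized t G)"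
proof -
  obtain xs ys as bs num den where
    lists: "distinct xs" "set xs = questX G" "distinct ys" "set ys = questY G"
      "distinct as" "set as = ansA G" "distinct bs" "set bs = ansB G"
    and prob: "\<And>x y. x \<in> questX G \<Longrightarrow> y \<in> questY G \<Longrightarrow>
      0 < den x y \<and> pmf (qdist G) (x, y) = real (num x y) / real (den x y)"
    and ws: "ws = [length xs, length ys, length as, length bs] @
          concat [[num x y, den x y]. x \<leftarrow> xs, y \<leftarrow> ys] @
          [of_bool (win G a b x y). x \<leftarrow> xs, y \<leftarrow> ys, a \<leftarrow> as, b \<leftarrow> bs]"
    using assms(2) unfolding encodes_game_def by blast
  define n m where "n = length xs" and "m = length ys"
  define q where "q = length as * length bs"
  define num' den' where "num' i j = num (xs ! i) (ys ! j)" and "den' i j = den (xs ! i) (ys ! j)" for i j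
  define bit where "bit i j c = answers_code as bs (Some (xs ! i)) (Some (ys ! j)) ! c" for i j c
  \<comment> \<open>\<open>K\<close> is at most \<open>2 ^ t * 2 ^ S\<close>, so its cube needs
    \<open>3 * S + 3 * t\<close> bits; the factor \<open>2 ^ 6\<close> leaves room for addresses and
    program constants. \<open>D\<close> exceeds \<open>n\<close>, \<open>m\<close>, \<open>q\<close>
    and \<open>t * S\<close>, which bounds \<open>K\<close>.\<close>
  define B D where "B = 3 * S + 3 * t + 6" and "D = 1 + (t + 1) * S"
  have card: "card (questX G) = n" "card (questY G) = m"
    using distinct_card[OF lists(1)] distinct_card[OF lists(3)] lists by (simp_all add: n_def m_def)
  have nm_pos: "0 < n" "0 < m"
    using questions_nonempty[OF game] lists by (auto simp: n_def m_def)
  have K: "K = t * n * m" by (simp add: K_def scale_def card)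
  have w: "rounded K G (xs ! i) (ys ! j) = K * num' i j div den' i j" if "i < n" "j < m" for i j
  proof -
    have "xs ! i \<in> questX G" "ys ! j \<in> questY G"
      using that lists by (auto simp: n_def m_def)
    then have "real K * pmf (qdist G) (xs ! i, ys ! j) = real (K * num' i j) / real (den' i j)"
      using prob by (simp add: num'_def den'_def)
    then show ?thesis
      \<comment> \<open>The floor of a quotient of naturals is their integer quotient, whether or
        not the fraction is reduced.\<close>
      unfolding rounded_def by (simp only: floor_divide_of_nat_eq nat_int)
  qed
  have weights: "concat [[num x y, den x y]. x \<leftarrow> xs, y \<leftarrow> ys] =
      concat (map (\<lambda>i. concat (map (\<lambda>j. [num' i j, den' i j]) [0..<m])) [0..<n])"
    unfolding concat_concat by (simp add: comp_def concat_map_nth[of _ xs] concat_map_nth[of _ ys] n_def m_def num'_def den'_def)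
  have answers: "[of_bool (win G a b x y). a \<leftarrow> as, b \<leftarrow> bs] = answers_code as bs (Some x) (Some y)" for x y
    by (simp add: answers_code_def)
  have bits: "[of_bool (win G a b x y). x \<leftarrow> xs, y \<leftarrow> ys, a \<leftarrow> as, b \<leftarrow> bs] =
      concat (map (\<lambda>i. concat (map (\<lambda>j. map (bit i j) [0..<q]) [0..<m])) [0..<n])"
  proof -
    have "map (bit i j) [0..<q] = answers_code as bs (Some (xs ! i)) (Some (ys ! j))" for i j
      using map_nth[of "answers_code as bs (Some (xs ! i)) (Some (ys ! j))"]
      by (simp add: bit_def[abs_def] q_def answers_code)
    then show ?thesis
      by (simp add: answers concat_map_nth[of _ xs] concat_map_nth[of _ ys] n_def m_def)
  qed
  have len: "length ws = 4 + 2 * (n * m) + n * m * q"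
    unfolding ws weights bits by (simp add: length_concat comp_def sum_list_triv)
  \<comment> \<open>Since the tables are listed explicitly, the code length bounds \<open>n\<close>,
    \<open>m\<close> and \<open>q\<close>. Each answer number alone is bounded only through its
    bits.\<close>
  have S: "4 + 2 * (n * m) + n * m * q \<le> S"
    using length_le_code_size[of ws] unfolding S_def len .
  have pow: "k < 2 ^ k" for k :: nat by simp
  have "n * 1 \<le> n * m" "1 * m \<le> n * m" "1 * q \<le> n * m * q"
    using nm_pos by (intro mult_le_mono; simp)+
  then have le_S: "n < S" "m < S" "q < S" "n * m < S" using S by linarith+
  have B: "2 ^ S * 2 ^ S * 2 ^ S * 2 ^ t * 2 ^ t * 2 ^ t * 64 = (2 ^ B :: nat)"
    by (simp add: B_def power_add mult_ac flip: power_mult) (simp add: power_mult power3_eq_cube)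
  have sum_eq: "(\<Sum>i<n. \<Sum>j<m. h (xs ! i) (ys ! j)) = (\<Sum>x\<in>questX G. \<Sum>y\<in>questY G. h x y)"
    for h :: "'x \<Rightarrow> 'y \<Rightarrow> nat"
  proof -
    have "(\<Sum>j<m. h x (ys ! j)) = (\<Sum>y\<in>questY G. h x y)" for x
      using sum_nth[OF lists(3), of "h x"] lists(4) by (simp add: m_def)
    then show ?thesis
      using sum_nth[OF lists(1), of "\<lambda>x. \<Sum>y\<in>questY G. h x y"] lists(2) by (simp add: n_def)
  qed
  have run: "regularize_run t n m (length as) (length bs) num' den' B D"
  proof
    \<comment> \<open>\<open>Suc n \<le> 2 * n\<close> because there is at least one question; thus
      padding enlarges the table by a factor of at most 4.\<close>
    have "Suc n * Suc m * Suc q \<le> (2 * n) * (2 * m) * Suc q"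
      using nm_pos by (intro mult_le_mono) auto
    also have "\<dots> = 4 * (n * m * q) + 4 * (n * m)" by simp
    also have "\<dots> \<le> 4 * S" using S by linarith
    finally have "2 * (Suc n * Suc m * Suc q) + 50 \<le> 8 * S + 50" by linarith
    also have "\<dots> \<le> 64 * 2 ^ S" using pow[of S] S by linarith
    also have "\<dots> = 1 * 1 * 2 ^ S * 1 * 1 * 1 * 64" by simp
    also have "\<dots> \<le> 2 ^ B" unfolding B[symmetric] by (intro mult_le_mono) simp_all
    finally show "2 * (Suc n * Suc m * Suc (length as * length bs)) + 50 \<le> 2 ^ B" by (simp only: q_def)
    have nm: "n * m \<le> 2 ^ S" using le_S pow[of S] by linarith
    have t: "t \<le> 2 ^ t" using pow[of t] by simp
    show "t * n * m * num' i j < 2 ^ B" if "i < n" "j < m" for i j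
    proof -
      have "num' i j \<in> set ws" using that unfolding ws weights by fastforce
      then have "num' i j < 2 ^ S" unfolding S_def by (rule member_le_code_size)
      then have "t * n * m * num' i j \<le> 2 ^ t * 2 ^ S * 2 ^ S"
        unfolding mult.assoc[of t n] using nm t by (intro mult_le_mono) auto
      also have "\<dots> = 2 ^ S * 2 ^ S * 1 * 2 ^ t * 1 * 1 * 1" by simp
      also have "\<dots> < 2 ^ S * 2 ^ S * 1 * 2 ^ t * 1 * 1 * 64" by simp
      also have "\<dots> \<le> 2 ^ B" unfolding B[symmetric] by (intro mult_le_mono) simp_all
      finally show ?thesis .
    qed
    have "t * n * m \<le> 2 ^ t * 2 ^ S"
      unfolding mult.assoc[of t n] using nm t by (intro mult_le_mono) auto
    then have "(t * n * m) ^ 3 \<le> (2 ^ t * 2 ^ S) ^ 3" by (intro power_mono) auto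
    also have "\<dots> = 2 ^ S * 2 ^ S * 2 ^ S * 2 ^ t * 2 ^ t * 2 ^ t" by (simp add: power3_eq_cube)
    also have "\<dots> < 2 ^ S * 2 ^ S * 2 ^ S * 2 ^ t * 2 ^ t * 2 ^ t * 64" by simp
    also have "\<dots> = 2 ^ B" by (rule B)
    finally show "(t * n * m) ^ 3 < 2 ^ B" .
    have "(\<Sum>i<n. \<Sum>j<m. t * n * m * num' i j div den' i j) =
        (\<Sum>i<n. \<Sum>j<m. rounded K G (xs ! i) (ys ! j))"
      unfolding K[symmetric] by (simp add: w)
    also have "\<dots> = (\<Sum>x\<in>questX G. \<Sum>y\<in>questY G. rounded K G x y)"
      by (rule sum_eq)
    also have "\<dots> \<le> t * n * m" using sum_rounded_le by (simp add: K)
    finally show "(\<Sum>i<n. \<Sum>j<m. t * n * m * num' i j div den' i j) \<le> t * n * m" .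
    show "Suc n \<le> D" "Suc m \<le> D" "length as * length bs \<le> D"
      using le_S by (simp_all add: D_def q_def)
    have "t * n * m \<le> t * S" using le_S by (simp add: mult.assoc)
    also have "\<dots> \<le> D" by (simp add: D_def)
    finally show "t * n * m \<le> D" .
    show "0 < m" by fact
  qed
  interpret run: regularize_run t n m "length as" "length bs" num' den' bit B D by (rule run)
  have runK: "run.K = K" and run_q: "run.q = q" by (simp_all add: run.K_def K run.q_def q_def)
  have W: "run.W i j = padded_weight K G (padded_list xs ! i) (padded_list ys ! j)"
    if "i < Suc n" "j < Suc m" for i j
  proof -
    have sum: "(\<Sum>i<n. \<Sum>j<m. run.w i j) = (\<Sum>x\<in>questX G. \<Sum>y\<in>questY G. rounded K G x y)"
      using sum_eq[of "rounded K G"] by (simp add: run.w_def runK w)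
    show ?thesis
      using that sum
      by (auto simp: run.W_def nth_append n_def[symmetric] m_def[symmetric] runK run.w_def w less_Suc_eq)
  qed
  have row: "run.row i = row (padded_list xs ! i)" if "i < Suc n" for i
    using sum_nth[OF padded_list(1)[OF lists(3)], of "padded_weight K G (padded_list xs ! i)"] that
    by (simp add: run.row_def row_def W run.M1_def lists m_def[symmetric] padded_list(2) del: set_append)
  have col: "run.col j = col (padded_list ys ! j)" if "j < Suc m" for j
    using sum_nth[OF padded_list(1)[OF lists(1)], of "\<lambda>s. padded_weight K G s (padded_list ys ! j)"] that
    by (simp add: run.col_def col_def W run.N1_def lists n_def[symmetric] padded_list(2) del: set_append)
  \<comment> \<open>Complementing twice restores the bits because they are 0 or 1; pairs with an
    additional question give 1.\<close>
  have lose: "map (\<lambda>c. 1 - run.lose i j c) [0..<q] = answers_code as bs (padded_list xs ! i) (padded_list ys ! j)"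
    if "i < Suc n" "j < Suc m" for i j
  proof (cases "i < n \<and> j < m")
    case True
    let ?a = "answers_code as bs (Some (xs ! i)) (Some (ys ! j))"
    have "1 - run.lose i j c = ?a ! c" if "c < q" for c
    proof -
      have "c < length ?a" using that by (simp add: answers_code(1) q_def)
      then have "?a ! c \<in> {0, 1}" using answers_code(2) by (rule set_mp[OF _ nth_mem, rotated])
      then show ?thesis using True by (auto simp: run.lose_def bit_def)
    qed
    then have "map (\<lambda>c. 1 - run.lose i j c) [0..<q] = map ((!) ?a) [0..<length ?a]"
      by (intro map_cong) (auto simp: answers_code q_def)
    also have "\<dots> = ?a" by (rule map_nth)
    finally show ?thesis using True by (simp add: nth_append n_def[symmetric] m_def[symmetric])
  next
    case False
    then have "i = n \<or> j = m" using that by auto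
    then have "answers_code as bs (padded_list xs ! i) (padded_list ys ! j) = replicate q 1"
      by (auto simp: nth_append n_def[symmetric] m_def[symmetric] answers_code(3,4) q_def)
    moreover have "map (\<lambda>c. 1 - run.lose i j c) [0..<q] = replicate q 1"
      using False by (intro replicate_eqI) (auto simp: run.lose_def)
    ultimately show ?thesis by simp
  qed
  have table: "run.table_output (\<lambda>i j. f (padded_list xs ! i) (padded_list ys ! j)) run.N1 =
      concat (map (\<lambda>s. rep (row s) (concat (map (\<lambda>r. rep (col r) (f s r)) (padded_list ys)))) (padded_list xs))"
    for f :: "_ \<Rightarrow> _ \<Rightarrow> nat list"
    unfolding run.table_output_def run.table_row_def run.N1_def run.M1_def
      concat_map_nth[of _ "padded_list xs"] concat_map_nth[of _ "padded_list ys"]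
    by (auto simp: row col n_def[symmetric] m_def[symmetric] simp del: upt_Suc intro!: arg_cong[of _ _ concat] arg_cong[of _ _ "rep _"])
  have table_cong: "run.table_output f run.N1 = run.table_output g run.N1"
    if "\<And>i j. i < Suc n \<Longrightarrow> j < Suc m \<Longrightarrow> f i j = g i j" for f g
    unfolding run.table_output_def run.table_row_def run.N1_def run.M1_def
    using that by (auto simp del: upt_Suc intro!: arg_cong[of _ _ concat] arg_cong[of _ _ "rep _"])
  have out: "[run.K, run.K, length as, length bs] @
      run.table_output (\<lambda>i j. [run.W i j, run.row i * run.col j * run.K]) run.N1 @
      run.table_output (\<lambda>i j. map (\<lambda>c. 1 - run.lose i j c) [0..<run.q]) run.N1 =
    [K, K, length as, length bs] @
      concat (map (\<lambda>s. rep (row s) (concat (map (\<lambda>r. rep (col r) [padded_weight K G s r, row s * col r * K])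
        (padded_list ys)))) (padded_list xs)) @
      concat (map (\<lambda>s. rep (row s) (concat (map (\<lambda>r. rep (col r) (answers_code as bs s r))
        (padded_list ys)))) (padded_list xs))"
  proof -
    have "run.table_output (\<lambda>i j. [run.W i j, run.row i * run.col j * run.K]) run.N1 =
      run.table_output (\<lambda>i j. [padded_weight K G (padded_list xs ! i) (padded_list ys ! j),
        row (padded_list xs ! i) * col (padded_list ys ! j) * K]) run.N1"
      by (rule table_cong) (simp only: W row col runK)
    moreover have "run.table_output (\<lambda>i j. map (\<lambda>c. 1 - run.lose i j c) [0..<run.q]) run.N1 =
      run.table_output (\<lambda>i j. answers_code as bs (padded_list xs ! i) (padded_list ys ! j)) run.N1"
      by (rule table_cong) (simp only: lose run_q)
    ultimately show ?thesis
      unfolding table[symmetric] runK by simp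
  qed
  have input: "ws = [n, m, length as, length bs] @ run.weights_code 0 @ run.bits_code 0"
    unfolding ws weights bits run.weights_code_def run.bits_code_def run_q by (simp add: n_def m_def)
  have "41 < (64 :: nat)" by simp
  also have "\<dots> \<le> 2 ^ B" unfolding B[symmetric] by simp
  finally have "41 < (2 :: nat) ^ B" .
  moreover have "t < 2 ^ B"
    using pow[of B] by (rule le_less_trans[rotated]) (simp add: B_def)
  ultimately have const_bound: "\<forall>k\<in>consts_com (regularize t). k < 2 ^ B"
    using consts_regularize[of t] by fastforce
  have "x < 2 ^ B" if "x \<in> set ws" for x
    using member_le_code_size[OF that] unfolding S_def[symmetric]
    by (rule less_le_trans) (simp add: B_def)
  then have small: "small B (\<lambda>_. 0, ws, [])" by (simp add: small_def)
  have "0 < B" by (simp add: B_def)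
  then obtain t' s inp ws' where "exec (regularize t) (\<lambda>_. 0, ws, []) t' (s, inp, ws')"
    "t' \<le> steps D (regularize t) * (10 * B)"
    "ws' = [run.K, run.K, length as, length bs] @
      run.table_output (\<lambda>i j. [run.W i j, run.row i * run.col j * run.K]) run.N1 @
      run.table_output (\<lambda>i j. map (\<lambda>c. 1 - run.lose i j c) [0..<run.q]) run.N1"
    using run.wp_regularize const_bound small unfolding wp_def input[symmetric] by fastforce
  then show ?thesis
    using encodes_regularized[OF lists] unfolding out answers_code_def B_def D_def by blast
qed

end

text \<open>\<open>t\<close> is a constant of the program, so the bound is a polynomial in the code
  size whose coefficients depend on \<open>t\<close>.\<close>

lemma poly_time_regularized:
  assumes "0 < t"
  shows "poly_time_computable encodes_game encodes_game two_player_game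
    (regularized t :: ('x, 'y, 'a, 'b) game \<Rightarrow> _)"
proof -
  obtain p where p: "\<And>D. steps D (regularize t) = poly p D"
    using steps_poly[of "regularize t"] by blast
  \<comment> \<open>The number of steps, a polynomial in the loop bound
    \<open>1 + (t + 1) * S\<close>, times the cost \<open>10 * B\<close> per step.\<close>
  let ?p = "pcompose p [:1, t + 1:] * [:10 * (3 * t + 6), 30:]"
  have bound: "steps (1 + (t + 1) * S) (regularize t) * (10 * (3 * S + 3 * t + 6)) = poly ?p S" for S
    by (simp add: p poly_pcompose algebra_simps)
  show ?thesis
    unfolding poly_time_computable_def
  proof (rule exI[of _ "regularize t"], rule exI[of _ ?p], intro allI impI)
    fix G :: "('x, 'y, 'a, 'b) game" and ws
    assume G: "two_player_game G \<and> encodes_game ws G"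
    then interpret rounded_game G t using assms by unfold_locales auto
    show "\<exists>s inp ws' t'. exec (regularize t) (\<lambda>_. 0, ws, []) t' (s, inp, ws') \<and>
        t' \<le> poly ?p (code_size ws) \<and> encodes_game ws' (regularized t G)"
      using regularize_correct[of ws] G unfolding bound by blast
  qed
qed

theorem lemma2p8:
  fixes \<tau> :: real
  assumes "0 < \<tau>" and "\<tau> < 1"
  shows "\<exists>Gint :: ('x, 'y, 'a, 'b) game \<Rightarrow> (nat, nat, 'a, 'b) game.
    poly_time_computable encodes_game encodes_game two_player_game Gint \<and>
    (\<forall>G. two_player_game G \<longrightarrow>
       two_player_game (Gint G) \<and> biregular (Gint G) \<and>
       real (card (questX (Gint G))) \<le> 8 * real (card (questX G))^2 * real (card (questY G)) / \<tau> \<and>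
       real (card (questY (Gint G))) \<le> 8 * real (card (questX G)) * real (card (questY G))^2 / \<tau> \<and>
       card (ansA (Gint G)) = card (ansA G) \<and> card (ansB (Gint G)) = card (ansB G) \<and>
       Val G \<le> Val (Gint G) \<and> Val (Gint G) \<le> Val G + \<tau> \<and>
       Val_star G \<le> Val_star (Gint G) \<and> Val_star (Gint G) \<le> Val_star G + \<tau>)"
proof -
  \<comment> \<open>Rounding up a number above 1 at most doubles it, so \<open>t\<close> lies
    between \<open>1 / \<tau>\<close> and \<open>2 / \<tau>\<close>.\<close>
  define t where "t = nat \<lceil>1 / \<tau>\<rceil>"
  have "1 < 1 / \<tau>" using assms by simp
  then have "1 / \<tau> \<le> t" "t \<le> 2 / \<tau>" "0 < t"
    unfolding t_def by linarith+
  then have t: "1 / t \<le> \<tau>" "t * \<tau> \<le> 2" using assms by (simp_all add: field_simps)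
  show ?thesis
  proof (rule exI[of _ "regularized t"], intro conjI allI impI poly_time_regularized \<open>0 < t\<close>)
    fix G :: "('x, 'y, 'a, 'b) game" assume "two_player_game G"
    then interpret rounded_game G t using \<open>0 < t\<close> by unfold_locales
    let ?n = "real (card (questX G))" and ?m = "real (card (questY G))"
    have nm: "1 \<le> ?n" "1 \<le> ?m"
      using finite_sets questions_nonempty[OF game] by (simp_all add: Suc_le_eq card_gt_0_iff)
    \<comment> \<open>\<open>t * \<tau> \<le> 2\<close> even gives 2|X||Y|/\<tau>; the claimed
      bounds allow a factor 4 more and a further factor |X| or |Y|, which is at least 1.\<close>
    have K_le: "K \<le> 8 * ?n * ?m / \<tau>"
    proof -
      have "t * \<tau> * (?n * ?m) \<le> 8 * (?n * ?m)" using t(2) by (intro mult_right_mono) auto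
      then show ?thesis using assms by (simp add: K_def scale_def field_simps)
    qed
    also have "\<dots> \<le> 8 * ?n ^ 2 * ?m / \<tau>"
      using nm assms by (intro divide_right_mono mult_right_mono mult_left_mono) (auto simp: power2_eq_square)
    finally show "real (card (questX (regularized t G))) \<le> 8 * ?n ^ 2 * ?m / \<tau>"
      by (simp add: regularized_sel)
    note K_le
    also have "8 * ?n * ?m / \<tau> \<le> 8 * ?n * ?m ^ 2 / \<tau>"
      using nm assms by (intro divide_right_mono mult_left_mono) (auto simp: power2_eq_square)
    finally show "real (card (questY (regularized t G))) \<le> 8 * ?n * ?m ^ 2 / \<tau>"
      by (simp add: regularized_sel)
  qed (use \<open>0 < t\<close> t(1) in \<open>auto simp: rounded_game_def rounded_game.regularized_sel rounded_game.game_regularized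
      rounded_game.biregular_regularized rounded_game.Val_close(1) rounded_game.Val_star_close(1)
      intro: order_trans[OF rounded_game.Val_close(2)] order_trans[OF rounded_game.Val_star_close(2)]\<close>)
qed

end
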